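(* Let $P$ be a right LCM semigroup with identity, let $\mathcal{S}$ be the inverse semigroup associated to $P$, let $\mathcal{Q}(P)$ be the boundary quotient of $C^*(P)$, and let $C^*_{\text{tight}}(\mathcal{S})$ be the tight C*-algebra of $\mathcal{S}$ with universal tight representation $\pi_t:\mathcal{S}\to C^*_{\text{tight}}(\mathcal{S})$. Then there is an isomorphism $\Phi:\mathcal{Q}(P)\to C^*_{\text{tight}}(\mathcal{S})$ such that $\Phi(v_pv_q^* )=\pi_t([p,q])$ for all $p,q\in P$.
   Context: All semigroups are countable and discrete. A semigroup $P$ is left cancellative if $pq=ps$ implies $q=s$. A principal right ideal is a set $pP=\{pq\mid q\in P\}$. $P$ is a right LCM semigroup if it is left cancellative and the intersection of any two principal right ideals is either empty or another principal right ideal. Write $1_P$ for the identity and $U(P)$ for the group of invertible elements of $P$. Inverse semigroup $\mathcal{S}$: define $(p,q)\sim(a,b)$ on $P\times P$ iff there is $u\in U(P)$ with $au=p$ and $bu=q$; let $[p,q]$ be the class of $(p,q)$. Then $\mathcal{S}=\{[p,q]\mid p,q\in P\}\cup\{0\}$ is an inverse semigroup with zero $0$ and identity $[1_P,1_P]$, with product $[a,b][c,d]=[ab',dc']$ if $cP\cap bP=rP$ and $cc'=bb'=r$, and $[a,b][c,d]=0$ if $cP\cap bP=\emptyset$. One has $[a,b]^*=[b,a]$ and the idempotents are $E(\mathcal{S})=\{[a,a]\mid a\in P\}\cup\{0\}$. Constructible ideals: for a right ideal $X$ and $p\in P$ put $pX=\{px\mid x\in X\}$ and $p^{-1}X=\{y\in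 P\mid py\in X\}$. $\mathcal{J}(P)$ is the smallest set of right ideals containing $P$ and $\emptyset$, closed under (finite) intersections, and such that $X\in\mathcal{J}(P)$, $p\in P$ imply $pX,p^{-1}X\in\mathcal{J}(P)$. (For a right LCM semigroup with identity it consists of the principal right ideals and $\emptyset$.) $C^*(P)$ is the universal C*-algebra generated by isometries $\{v_p\mid p\in P\}$ and projections $\{e_X\mid X\in\mathcal{J}(P)\}$ subject to: (L1) $v_pv_q=v_{pq}$; (L2) $v_pe_Xv_p^*=e_{pX}$; (L3) $e_P=1$ and $e_\emptyset=0$; (L4) $e_Xe_Y=e_{X\cap Y}$. A finite set $F\subset P$ is a foundation set if for all $p\in P$ there is $f\in F$ with $fP\cap pP\neq\emptyset$. The boundary quotient $\mathcal{Q}(P)$ is the universal C*-algebra generated by $\{v_p\}$, $\{e_X\}$ subject to (L1)--(L4) and $\prod_{p\in F}(1-e_{pP})=0$ for all foundation sets $F\subset P$. Tight representations: a representation of an inverse semigroup $S$ with zero in a unital C*-algebra $A$ is a map $\pi:S\to A$ with $\pi(st)=\pi(s)\pi(t)$, $\pi(s^* )=\pi(s)^*$, $\pi(0)=0$. For $F\subset Z\subset E(S)$, $F$ is a cover of $Z$ if for every nonzero $z\in Z$ there is $f\in F$ with $fz\neq0$. For finite $X,Y\subset E(S)$ let $E(S)^{X,Y}=\{e\in E(S)\mid ex=e\ \forall x\in X,\ ey=0\ \forall y\in Y\}$. $\pi$ is tight if for all finite $X,Y\subset E(S)$ and every finite cover $Z$ of $E(S)^{X,Y}$, $\bigvee_{z\in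 Z}\pi(z)=\prod_{x\in X}\pi(x)\prod_{y\in Y}(1-\pi(y))$, where for commuting projections $e\vee f=e+f-ef$ (empty products are $1$, empty joins are $0$). $C^*_{\text{tight}}(S)$ is the universal C*-algebra generated by one element for each element of $S$ subject to the relations saying that the standard map $\pi_t:S\to C^*_{\text{tight}}(S)$ is a tight representation. *)

theory Defs
  imports "HOL-Analysis.Analysis" "HOL-Library.Poly_Mapping" "HOL-Library.Countable"
    "HOL-Library.Quotient_Option"
begin

section \<open>Unital complex star-algebras and unital C*-algebras\<close>

class star =
  fixes star :: "'a \<Rightarrow> 'a"  (\<open>(_\<^sup>\<star>)\<close> [1000] 1000)

class scaleC =
  fixes scaleC :: "complex \<Rightarrow> 'a \<Rightarrow> 'a"  (infixr \<open>*\<^sub>C\<close> 75)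

(* The unit comes from monoid_mult rather than ring_1, so the zero algebra is not excluded. *)
class star_algebra = ring + monoid_mult + scaleC + star +
  assumes scaleC_add_right: "a *\<^sub>C (x + y) = a *\<^sub>C x + a *\<^sub>C y"
    and scaleC_add_left: "(a + b) *\<^sub>C x = a *\<^sub>C x + b *\<^sub>C x"
    and scaleC_scaleC: "a *\<^sub>C b *\<^sub>C x = (a * b) *\<^sub>C x"
    and scaleC_one: "1 *\<^sub>C x = x"
    and mult_scaleC_left: "(a *\<^sub>C x) * y = a *\<^sub>C (x * y)"
    and mult_scaleC_right: "x * (a *\<^sub>C y) = a *\<^sub>C (x * y)"
    and star_star: "x\<^sup>\<star>\<^sup>\<star> = x"
    and star_add: "(x + y)\<^sup>\<star> = x\<^sup>\<star> + y\<^sup>\<star>"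
    and star_mult: "(x * y)\<^sup>\<star> = y\<^sup>\<star> * x\<^sup>\<star>"
    and star_scaleC: "(a *\<^sub>C x)\<^sup>\<star> = cnj a *\<^sub>C x\<^sup>\<star>"
begin

lemma scaleC_zero_left [simp]: "0 *\<^sub>C x = 0"
  using scaleC_add_left[of 0 0 x] by simp

lemma scaleC_zero_right [simp]: "a *\<^sub>C 0 = 0"
  using scaleC_add_right[of a 0 0] by simp

lemma scaleC_minus_left: "(- a) *\<^sub>C x = - (a *\<^sub>C x)"
  using scaleC_add_left[of a "- a" x] by (simp add: eq_neg_iff_add_eq_0 add.commute)

lemma scaleC_minus_right: "a *\<^sub>C (- x) = - (a *\<^sub>C x)"
  using scaleC_add_right[of a x "- x"] by (simp add: eq_neg_iff_add_eq_0 add.commute)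

lemma scaleC_diff_right: "a *\<^sub>C (x - y) = a *\<^sub>C x - a *\<^sub>C y"
  using scaleC_add_right[of a x "- y"] by (simp add: scaleC_minus_right)

lemma star_zero [simp]: "0\<^sup>\<star> = 0"
  using star_add[of 0 0] by simp

lemma star_minus: "(- x)\<^sup>\<star> = - x\<^sup>\<star>"
  using star_add[of x "- x"] by (simp add: eq_neg_iff_add_eq_0 add.commute)

lemma star_diff: "(x - y)\<^sup>\<star> = x\<^sup>\<star> - y\<^sup>\<star>"
  using star_add[of x "- y"] by (simp add: star_minus)

lemma star_one [simp]: "1\<^sup>\<star> = 1"
  by (metis mult.left_neutral mult.right_neutral star_mult star_star)

end

class cstar_algebra = star_algebra + real_normed_algebra + banach +
  assumes scaleR_scaleC: "scaleR r x = complex_of_real r *\<^sub>C x"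
    and norm_scaleC: "norm (a *\<^sub>C x) = cmod a * norm x"
    and norm_star_mult: "norm (x\<^sup>\<star> * x) = (norm x)\<^sup>2"

definition star_homomorphism :: "('a::star_algebra \<Rightarrow> 'b::star_algebra) \<Rightarrow> bool" where
  "star_homomorphism f \<longleftrightarrow>
     (\<forall>x y. f (x + y) = f x + f y) \<and> (\<forall>a x. f (a *\<^sub>C x) = a *\<^sub>C f x) \<and>
     (\<forall>x y. f (x * y) = f x * f y) \<and> (\<forall>x. f (x\<^sup>\<star>) = (f x)\<^sup>\<star>) \<and> f 1 = 1"

definition star_isomorphism :: "('a::star_algebra \<Rightarrow> 'b::star_algebra) \<Rightarrow> bool" where
  "star_isomorphism f \<longleftrightarrow> star_homomorphism f \<and> bij f"

definition cstar_seminorm :: "('a::star_algebra \<Rightarrow> real) \<Rightarrow> bool" where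
  "cstar_seminorm \<rho> \<longleftrightarrow>
     (\<forall>x y. \<rho> (x + y) \<le> \<rho> x + \<rho> y) \<and> (\<forall>a x. \<rho> (a *\<^sub>C x) = cmod a * \<rho> x) \<and>
     (\<forall>x y. \<rho> (x * y) \<le> \<rho> x * \<rho> y) \<and> (\<forall>x. \<rho> (x\<^sup>\<star> * x) = (\<rho> x)\<^sup>2)"

context
  fixes \<rho> :: "'a::star_algebra \<Rightarrow> real"
  assumes \<rho>: "cstar_seminorm \<rho>"
begin

lemma cstar_seminorm_triangle: "\<rho> (x + y) \<le> \<rho> x + \<rho> y"
  using \<rho> by (simp add: cstar_seminorm_def)

lemma cstar_seminorm_scale: "\<rho> (a *\<^sub>C x) = cmod a * \<rho> x"
  using \<rho> by (simp add: cstar_seminorm_def)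

lemma cstar_seminorm_mult: "\<rho> (x * y) \<le> \<rho> x * \<rho> y"
  using \<rho> by (simp add: cstar_seminorm_def)

lemma cstar_seminorm_star_mult: "\<rho> (x\<^sup>\<star> * x) = (\<rho> x)\<^sup>2"
  using \<rho> by (simp add: cstar_seminorm_def)

lemma cstar_seminorm_zero: "\<rho> 0 = 0"
  using cstar_seminorm_scale[of 0 0] by simp

lemma cstar_seminorm_minus: "\<rho> (- x) = \<rho> x"
  using cstar_seminorm_scale[of "-1" x] by (simp add: scaleC_minus_left scaleC_one)

lemma cstar_seminorm_nonneg: "0 \<le> \<rho> x"
  using cstar_seminorm_triangle[of x "- x"] cstar_seminorm_minus[of x] cstar_seminorm_zero by simp

lemma cstar_seminorm_star: "\<rho> (x\<^sup>\<star>) = \<rho> x"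
proof -
  have le: "\<rho> y \<le> \<rho> (y\<^sup>\<star>)" for y
  proof (cases "\<rho> y = 0")
    case False
    then have "0 < \<rho> y" using cstar_seminorm_nonneg[of y] by simp
    moreover have "\<rho> y * \<rho> y \<le> \<rho> (y\<^sup>\<star>) * \<rho> y"
      using cstar_seminorm_mult[of "y\<^sup>\<star>" y] cstar_seminorm_star_mult[of y]
      by (simp add: power2_eq_square)
    ultimately show ?thesis by simp
  qed (simp add: cstar_seminorm_nonneg)
  from le[of x] le[of "x\<^sup>\<star>"] show ?thesis by (simp add: star_star)
qed

lemma cstar_seminorm_le_1:
  assumes "x\<^sup>\<star> * x = e" "\<rho> e \<le> 1"
  shows "\<rho> x \<le> 1"
  using assms cstar_seminorm_star_mult[of x]
  by (metis cstar_seminorm_nonneg power_le_one_iff zero_neq_numeral)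

lemma cstar_seminorm_diff_triangle: "\<rho> (x - z) \<le> \<rho> (x - y) + \<rho> (y - z)"
  using cstar_seminorm_triangle[of "x - y" "y - z"] by simp

lemma cstar_seminorm_diff_commute: "\<rho> (x - y) = \<rho> (y - x)"
  using cstar_seminorm_minus[of "x - y"] by simp

lemma cstar_seminorm_eq:
  assumes "\<rho> (x - y) = 0" shows "\<rho> x = \<rho> y"
  using cstar_seminorm_triangle[of "x - y" y] cstar_seminorm_triangle[of "y - x" x]
    cstar_seminorm_diff_commute[of x y] assms by simp

lemma cstar_seminorm_projection_le_1:
  assumes "\<rho> (x\<^sup>\<star> * x - x) = 0"
  shows "\<rho> x \<le> 1"
proof -
  have "(\<rho> x)\<^sup>2 = \<rho> x"
    using cstar_seminorm_eq[OF assms] by (simp add: cstar_seminorm_star_mult)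
  then show ?thesis
    by (metis order_refl power2_eq_square mult_cancel_left1 zero_le_one)
qed

lemma cstar_seminorm_one_le_1: "\<rho> 1 \<le> 1"
  by (rule cstar_seminorm_projection_le_1) (simp add: cstar_seminorm_zero)

end


section \<open>The free unital star-algebra on a set of generators\<close>

(* A letter (g, True) stands for the adjoint of the generator g. *)
datatype 'g word = Word (letters: "('g \<times> bool) list")

instantiation word :: (type) monoid_add
begin
definition "0 = Word []"
definition "v + w = Word (letters v @ letters w)"
instance
  by standard (auto simp: zero_word_def plus_word_def)
end

definition adjoint_word :: "'g word \<Rightarrow> 'g word" where
  "adjoint_word w = Word (rev (map (\<lambda>(g, b). (g, \<not> b)) (letters w)))"

lemma adjoint_word_invol [simp]: "adjoint_word (adjoint_word w) = w"
  by (cases w) (auto simp: adjoint_word_def rev_map o_def case_prod_unfold)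

lemma adjoint_word_add: "adjoint_word (v + w) = adjoint_word w + adjoint_word v"
  by (simp add: adjoint_word_def plus_word_def)

lemma adjoint_word_0 [simp]: "adjoint_word 0 = 0"
  by (simp add: adjoint_word_def zero_word_def)

lemma inj_adjoint_word [simp]: "inj adjoint_word"
  by (metis adjoint_word_invol injI)

typedef 'g free_star_algebra = "UNIV :: ('g word \<Rightarrow>\<^sub>0 complex) set" ..

setup_lifting type_definition_free_star_algebra

lemma poly_mapping_additive_induct:
  assumes "P 0" "\<And>k v. P (Poly_Mapping.single k v)" "\<And>f g. P f \<Longrightarrow> P g \<Longrightarrow> P (f + g)"
  shows "P (f :: 'k \<Rightarrow>\<^sub>0 'v::comm_monoid_add)"
proof (induction f rule: update_induct)
  case (update f a b)
  have "Poly_Mapping.update a b f = f + Poly_Mapping.single a b"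
    using update by (intro poly_mapping_eqI)
      (auto simp: lookup_update lookup_add lookup_single when_def in_keys_iff)
  then show ?case using update assms by simp
qed (fact assms)

lemma poly_mapping_single0_commute:
  fixes f :: "'k::monoid_add \<Rightarrow>\<^sub>0 complex"
  shows "f * Poly_Mapping.single 0 a = Poly_Mapping.single 0 a * f"
  by (induction f rule: poly_mapping_additive_induct)
    (simp_all add: mult_single mult.commute distrib_left distrib_right)

definition poly_mapping_star :: "('g word \<Rightarrow>\<^sub>0 complex) \<Rightarrow> ('g word \<Rightarrow>\<^sub>0 complex)" where
  "poly_mapping_star f = Poly_Mapping.map_key adjoint_word (Poly_Mapping.map cnj f)"

lemma lookup_poly_mapping_star:
  "Poly_Mapping.lookup (poly_mapping_star f) w = cnj (Poly_Mapping.lookup f (adjoint_word w))"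
  by (simp add: poly_mapping_star_def map_key.rep_eq map.rep_eq when_def)

lemma poly_mapping_star_add: "poly_mapping_star (f + g) = poly_mapping_star f + poly_mapping_star g"
  by (rule poly_mapping_eqI) (simp add: lookup_poly_mapping_star lookup_add)

lemma poly_mapping_star_single:
  "poly_mapping_star (Poly_Mapping.single w a) = Poly_Mapping.single (adjoint_word w) (cnj a)"
  by (rule poly_mapping_eqI) (auto simp: lookup_poly_mapping_star lookup_single when_def)

lemma poly_mapping_star_zero: "poly_mapping_star 0 = 0"
  by (rule poly_mapping_eqI) (simp add: lookup_poly_mapping_star)

lemma poly_mapping_star_mult:
  "poly_mapping_star (f * g) = poly_mapping_star g * poly_mapping_star f"
proof (induction f rule: poly_mapping_additive_induct)
  case (2 k v)
  show ?case
    by (induction g rule: poly_mapping_additive_induct)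
      (simp_all add: mult_single mult.commute distrib_left distrib_right poly_mapping_star_add
        poly_mapping_star_single poly_mapping_star_zero adjoint_word_add)
qed (simp_all add: distrib_left distrib_right poly_mapping_star_add poly_mapping_star_zero)

instantiation free_star_algebra :: (type) star_algebra
begin
lift_definition zero_free_star_algebra :: "'a free_star_algebra" is 0 .
lift_definition one_free_star_algebra :: "'a free_star_algebra" is 1 .
lift_definition plus_free_star_algebra ::
  "'a free_star_algebra \<Rightarrow> 'a free_star_algebra \<Rightarrow> 'a free_star_algebra" is "(+)" .
lift_definition minus_free_star_algebra ::
  "'a free_star_algebra \<Rightarrow> 'a free_star_algebra \<Rightarrow> 'a free_star_algebra" is "(-)" .
lift_definition uminus_free_star_algebra ::
  "'a free_star_algebra \<Rightarrow> 'a free_star_algebra" is "uminus" .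
(* convolution product of Poly_Mapping, i.e. concatenation of words extended bilinearly *)
lift_definition times_free_star_algebra ::
  "'a free_star_algebra \<Rightarrow> 'a free_star_algebra \<Rightarrow> 'a free_star_algebra" is "(*)" .
lift_definition scaleC_free_star_algebra ::
  "complex \<Rightarrow> 'a free_star_algebra \<Rightarrow> 'a free_star_algebra"
  is "\<lambda>a f. Poly_Mapping.single 0 a * f" .
lift_definition star_free_star_algebra ::
  "'a free_star_algebra \<Rightarrow> 'a free_star_algebra" is poly_mapping_star .
instance
proof
  fix a b :: complex and x y z :: "'a free_star_algebra"
  show "x * y * z = x * (y * z)" by transfer (simp add: mult.assoc)
  show "x + y + z = x + (y + z)" by transfer (simp add: add.assoc)
  show "x + y = y + x" by transfer (simp add: add.commute)
  show "0 + x = x" "- x + x = 0" by (transfer, simp)+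
  show "x - y = x + - y" by transfer simp
  show "(x + y) * z = x * z + y * z" by transfer (simp add: distrib_right)
  show "x * (y + z) = x * y + x * z" by transfer (simp add: distrib_left)
  show "1 * x = x" "x * 1 = x" by (transfer, simp)+
  show "a *\<^sub>C (x + y) = a *\<^sub>C x + a *\<^sub>C y" by transfer (simp add: distrib_left)
  show "(a + b) *\<^sub>C x = a *\<^sub>C x + b *\<^sub>C x" by transfer (simp add: distrib_right single_add)
  show "a *\<^sub>C b *\<^sub>C x = (a * b) *\<^sub>C x" by transfer (simp add: mult_single flip: mult.assoc)
  show "1 *\<^sub>C x = x" by transfer simp
  show "(a *\<^sub>C x) * y = a *\<^sub>C (x * y)" by transfer (simp add: mult.assoc)
  show "x * (a *\<^sub>C y) = a *\<^sub>C (x * y)"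
    by transfer (metis mult.assoc poly_mapping_single0_commute)
  show "x\<^sup>\<star>\<^sup>\<star> = x" by transfer (rule poly_mapping_eqI, simp add: lookup_poly_mapping_star)
  show "(x + y)\<^sup>\<star> = x\<^sup>\<star> + y\<^sup>\<star>" by transfer (rule poly_mapping_star_add)
  show "(x * y)\<^sup>\<star> = y\<^sup>\<star> * x\<^sup>\<star>" by transfer (rule poly_mapping_star_mult)
  show "(a *\<^sub>C x)\<^sup>\<star> = cnj a *\<^sub>C x\<^sup>\<star>"
    by transfer (simp add: poly_mapping_star_mult poly_mapping_star_single poly_mapping_single0_commute)
qed
end

lift_definition free_gen :: "'g \<Rightarrow> 'g free_star_algebra"
  is "\<lambda>g. Poly_Mapping.single (Word [(g, False)]) 1" .

lemma free_star_algebra_induct: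
  assumes scale: "\<And>a x. P x \<Longrightarrow> P (a *\<^sub>C x)" and add: "\<And>x y. P x \<Longrightarrow> P y \<Longrightarrow> P (x + y)"
    and one: "P 1" and mult: "\<And>x y. P x \<Longrightarrow> P y \<Longrightarrow> P (x * y)"
    and gen: "\<And>g. P (free_gen g)" and star: "\<And>x. P x \<Longrightarrow> P (x\<^sup>\<star>)"
  shows "P x"
proof -
  define Q where "Q f = P (Abs_free_star_algebra f)" for f
  have word: "Q (Poly_Mapping.single (Word w) 1)" for w
  proof (induction w)
    case Nil
    show ?case using one by (simp add: Q_def one_free_star_algebra.abs_eq flip: zero_word_def)
  next
    case (Cons a w)
    obtain g b where a: "a = (g, b)" by fastforce
    have G: "Q (Poly_Mapping.single (Word [a]) 1)"
    proof (cases b)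
      case False
      then show ?thesis using gen[of g] by (simp add: a Q_def free_gen.abs_eq)
    next
      case True
      then have "Abs_free_star_algebra (Poly_Mapping.single (Word [a]) 1) = (free_gen g)\<^sup>\<star>"
        by (simp add: a free_gen.abs_eq star_free_star_algebra.abs_eq poly_mapping_star_single
            adjoint_word_def)
      then show ?thesis using star gen by (simp add: Q_def)
    qed
    have "Abs_free_star_algebra (Poly_Mapping.single (Word (a # w)) 1) =
        Abs_free_star_algebra (Poly_Mapping.single (Word [a]) 1)
        * Abs_free_star_algebra (Poly_Mapping.single (Word w) 1)"
      by (simp add: times_free_star_algebra.abs_eq mult_single plus_word_def)
    then show ?case using G Cons mult by (simp add: Q_def)
  qed
  have single: "Q (Poly_Mapping.single k v)" for k v
  proof -
    obtain w where w: "k = Word w" by (cases k)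
    have "Abs_free_star_algebra (Poly_Mapping.single k v) =
        v *\<^sub>C Abs_free_star_algebra (Poly_Mapping.single k 1)"
      by (simp add: scaleC_free_star_algebra.abs_eq mult_single)
    then show ?thesis using word[of w] scale by (simp add: Q_def w)
  qed
  have "Q f" for f
  proof (induction f rule: poly_mapping_additive_induct)
    case 1
    show ?case using scale[OF one, of 0] by (simp add: Q_def flip: zero_free_star_algebra.abs_eq)
  next
    case (3 f g)
    then show ?case using add by (auto simp: Q_def plus_free_star_algebra.abs_eq[symmetric])
  qed (rule single)
  then show ?thesis by (metis Q_def Rep_free_star_algebra_inverse)
qed

context
  fixes f :: "'g \<Rightarrow> 'a::star_algebra"
begin

definition eval_word :: "'g word \<Rightarrow> 'a" where
  "eval_word w = prod_list (map (\<lambda>(g, b). if b then (f g)\<^sup>\<star> else f g) (letters w))"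

lemma eval_word_add: "eval_word (v + w) = eval_word v * eval_word w"
  by (simp add: eval_word_def plus_word_def)

lemma eval_word_0: "eval_word 0 = 1"
  by (simp add: eval_word_def zero_word_def)

lemma eval_word_adjoint: "eval_word (adjoint_word w) = (eval_word w)\<^sup>\<star>"
proof (cases w)
  case (Word l)
  have "prod_list (map (\<lambda>(g, b). if b then (f g)\<^sup>\<star> else f g) (rev (map (\<lambda>(g, b). (g, \<not> b)) l)))
     = (prod_list (map (\<lambda>(g, b). if b then (f g)\<^sup>\<star> else f g) l))\<^sup>\<star>"
    by (induction l) (auto simp: star_mult star_star)
  then show ?thesis by (simp add: Word eval_word_def adjoint_word_def)
qed

definition eval_poly :: "('g word \<Rightarrow>\<^sub>0 complex) \<Rightarrow> 'a" where
  "eval_poly p = (\<Sum>w\<in>Poly_Mapping.keys p. Poly_Mapping.lookup p w *\<^sub>C eval_word w)"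

lemma eval_poly_superset:
  assumes "finite A" "Poly_Mapping.keys p \<subseteq> A"
  shows "eval_poly p = (\<Sum>w\<in>A. Poly_Mapping.lookup p w *\<^sub>C eval_word w)"
  unfolding eval_poly_def
  by (rule sum.mono_neutral_left) (use assms in \<open>auto simp: in_keys_iff\<close>)

lemma eval_poly_zero: "eval_poly 0 = 0"
  by (simp add: eval_poly_def)

lemma eval_poly_single: "eval_poly (Poly_Mapping.single w a) = a *\<^sub>C eval_word w"
  by (subst eval_poly_superset[of "{w}"]) (auto simp: lookup_single split: if_splits)

lemma eval_poly_add: "eval_poly (p + q) = eval_poly p + eval_poly q"
proof -
  let ?A = "Poly_Mapping.keys p \<union> Poly_Mapping.keys q"
  have "eval_poly (p + q) = (\<Sum>w\<in>?A. Poly_Mapping.lookup (p + q) w *\<^sub>C eval_word w)"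
    by (rule eval_poly_superset) (use Poly_Mapping.keys_add[of p q] in \<open>auto simp del: in_keys_iff\<close>)
  also have "\<dots> = (\<Sum>w\<in>?A. Poly_Mapping.lookup p w *\<^sub>C eval_word w)
      + (\<Sum>w\<in>?A. Poly_Mapping.lookup q w *\<^sub>C eval_word w)"
    by (simp add: lookup_add scaleC_add_left sum.distrib)
  also have "\<dots> = eval_poly p + eval_poly q"
    by (subst (1 2) eval_poly_superset[of ?A]) auto
  finally show ?thesis .
qed

lemma eval_poly_mult: "eval_poly (p * q) = eval_poly p * eval_poly q"
proof (induction p rule: poly_mapping_additive_induct)
  case (2 k v)
  show ?case
    by (induction q rule: poly_mapping_additive_induct)
      (simp_all add: mult_single distrib_left eval_poly_zero eval_poly_single eval_poly_add
        eval_word_add mult_scaleC_left mult_scaleC_right scaleC_scaleC mult.commute)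
qed (simp_all add: distrib_right eval_poly_zero eval_poly_add)

lemma eval_poly_star: "eval_poly (poly_mapping_star p) = (eval_poly p)\<^sup>\<star>"
  by (induction p rule: poly_mapping_additive_induct)
    (simp_all add: poly_mapping_star_zero poly_mapping_star_single poly_mapping_star_add
      eval_poly_zero eval_poly_single eval_poly_add eval_word_adjoint star_scaleC star_add)

lift_definition free_eval :: "'g free_star_algebra \<Rightarrow> 'a" is eval_poly .

lemma star_homomorphism_free_eval: "star_homomorphism free_eval"
  unfolding star_homomorphism_def
  apply (intro conjI allI; transfer)
      apply (simp_all add: eval_poly_add eval_poly_mult eval_poly_single eval_word_0 mult_scaleC_left
      eval_poly_star)
  by (metis eval_poly_single eval_word_0 scaleC_one single_one)

lemma free_eval_gen [simp]: "free_eval (free_gen g) = f g"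
  by transfer (simp add: eval_poly_single eval_word_def scaleC_one)

end


section \<open>Completion of a star-algebra with respect to a C*-seminorm\<close>

class cstar_seminormed_algebra = star_algebra +
  fixes seminorm :: "'a \<Rightarrow> real"
  assumes seminorm_triangle: "seminorm (x + y) \<le> seminorm x + seminorm y"
    and seminorm_scaleC: "seminorm (a *\<^sub>C x) = cmod a * seminorm x"
    and seminorm_mult: "seminorm (x * y) \<le> seminorm x * seminorm y"
    and seminorm_star_mult: "seminorm (x\<^sup>\<star> * x) = (seminorm x)\<^sup>2"

lemma cstar_seminorm_seminorm: "cstar_seminorm seminorm"
  by (simp add: cstar_seminorm_def seminorm_triangle seminorm_scaleC seminorm_mult seminorm_star_mult)

lemmas seminorm_simps = cstar_seminorm_zero[OF cstar_seminorm_seminorm]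
  cstar_seminorm_minus[OF cstar_seminorm_seminorm]
  cstar_seminorm_star[OF cstar_seminorm_seminorm]
  seminorm_scaleC
lemmas seminorm_nonneg = cstar_seminorm_nonneg[OF cstar_seminorm_seminorm]
lemmas seminorm_diff_triangle = cstar_seminorm_diff_triangle[OF cstar_seminorm_seminorm]
lemmas seminorm_diff_commute = cstar_seminorm_diff_commute[OF cstar_seminorm_seminorm]

definition seminorm_Cauchy :: "(nat \<Rightarrow> 'a::cstar_seminormed_algebra) \<Rightarrow> bool" where
  "seminorm_Cauchy X \<longleftrightarrow> (\<forall>e>0. \<exists>M. \<forall>m\<ge>M. \<forall>n\<ge>M. seminorm (X m - X n) < e)"

definition seminorm_equiv :: "(nat \<Rightarrow> 'a::cstar_seminormed_algebra) \<Rightarrow> (nat \<Rightarrow> 'a) \<Rightarrow> bool" where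
  "seminorm_equiv X Y \<longleftrightarrow>
     seminorm_Cauchy X \<and> seminorm_Cauchy Y \<and> (\<lambda>n. seminorm (X n - Y n)) \<longlonglongrightarrow> 0"

lemma seminorm_equiv_refl [simp]: "seminorm_equiv X X \<longleftrightarrow> seminorm_Cauchy X"
  by (simp add: seminorm_equiv_def seminorm_simps)

lemma seminorm_Cauchy_const: "seminorm_Cauchy (\<lambda>n. x)"
  by (simp add: seminorm_Cauchy_def seminorm_simps)

lemma seminorm_tendsto_0I:
  assumes "g \<longlonglongrightarrow> 0" "\<And>n. seminorm (X n) \<le> g n"
  shows "(\<lambda>n. seminorm (X n)) \<longlonglongrightarrow> 0"
  by (rule tendsto_sandwich[OF _ _ tendsto_const assms(1)])
    (auto simp: assms seminorm_nonneg)

lemma part_equivp_seminorm_equiv: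
  "part_equivp (seminorm_equiv :: (nat \<Rightarrow> 'a::cstar_seminormed_algebra) \<Rightarrow> _)"
proof (rule part_equivpI)
  show "\<exists>X. seminorm_equiv X (X :: nat \<Rightarrow> 'a)"
    using seminorm_Cauchy_const by auto
  show "symp (seminorm_equiv :: (nat \<Rightarrow> 'a) \<Rightarrow> _)"
  proof (rule sympI)
    fix X Y :: "nat \<Rightarrow> 'a" assume "seminorm_equiv X Y"
    then show "seminorm_equiv Y X"
      by (simp add: seminorm_equiv_def seminorm_diff_commute)
  qed
  show "transp (seminorm_equiv :: (nat \<Rightarrow> 'a) \<Rightarrow> _)"
  proof (rule transpI)
    fix X Y Z :: "nat \<Rightarrow> 'a" assume *: "seminorm_equiv X Y" "seminorm_equiv Y Z"
    have "(\<lambda>n. seminorm (X n - Y n) + seminorm (Y n - Z n)) \<longlonglongrightarrow> 0"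
      using tendsto_add[of "\<lambda>n. seminorm (X n - Y n)" 0 _ "\<lambda>n. seminorm (Y n - Z n)" 0] *
      by (simp add: seminorm_equiv_def)
    then have "(\<lambda>n. seminorm (X n - Z n)) \<longlonglongrightarrow> 0"
      by (rule seminorm_tendsto_0I) (rule seminorm_diff_triangle)
    then show "seminorm_equiv X Z" using * by (simp add: seminorm_equiv_def)
  qed
qed

quotient_type (overloaded) 'a cstar_completion =
  "nat \<Rightarrow> 'a::cstar_seminormed_algebra" / partial: seminorm_equiv
  by (rule part_equivp_seminorm_equiv)

lemma seminorm_Cauchy_add:
  assumes "seminorm_Cauchy X" "seminorm_Cauchy Y"
  shows "seminorm_Cauchy (\<lambda>n. X n + Y n)"
  unfolding seminorm_Cauchy_def
proof (intro allI impI)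
  fix e :: real assume "0 < e"
  then have "0 < e / 2" by simp
  then obtain M N where "\<forall>m\<ge>M. \<forall>n\<ge>M. seminorm (X m - X n) < e / 2"
    "\<forall>m\<ge>N. \<forall>n\<ge>N. seminorm (Y m - Y n) < e / 2"
    using assms unfolding seminorm_Cauchy_def by meson
  moreover have "seminorm (X m + Y m - (X n + Y n)) \<le> seminorm (X m - X n) + seminorm (Y m - Y n)"
    for m n using seminorm_triangle[of "X m - X n" "Y m - Y n"] by (simp add: algebra_simps)
  ultimately show "\<exists>M. \<forall>m\<ge>M. \<forall>n\<ge>M. seminorm (X m + Y m - (X n + Y n)) < e"
    by (intro exI[of _ "max M N"]) (smt (verit) field_sum_of_halves max.bounded_iff)
qed

lemma seminorm_Cauchy_uminus: "seminorm_Cauchy X \<Longrightarrow> seminorm_Cauchy (\<lambda>n. - X n)"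
  by (simp add: seminorm_Cauchy_def) (metis add.commute seminorm_diff_commute uminus_add_conv_diff)

lemma seminorm_Cauchy_diff:
  "seminorm_Cauchy X \<Longrightarrow> seminorm_Cauchy Y \<Longrightarrow> seminorm_Cauchy (\<lambda>n. X n - Y n)"
  using seminorm_Cauchy_add[OF _ seminorm_Cauchy_uminus, of X Y] by simp

lemma seminorm_Cauchy_star: "seminorm_Cauchy X \<Longrightarrow> seminorm_Cauchy (\<lambda>n. (X n)\<^sup>\<star>)"
  by (simp add: seminorm_Cauchy_def seminorm_simps flip: star_diff)

lemma seminorm_Cauchy_scaleC: 
  assumes "seminorm_Cauchy X" shows "seminorm_Cauchy (\<lambda>n. a *\<^sub>C X n)"
  unfolding seminorm_Cauchy_def
proof (intro allI impI)
  fix e :: real assume e: "0 < e"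
  have "0 < e / (cmod a + 1)" using e by (intro divide_pos_pos) (auto simp: add_nonneg_pos)
  then obtain M where M: "\<forall>m\<ge>M. \<forall>n\<ge>M. seminorm (X m - X n) < e / (cmod a + 1)"
    using assms unfolding seminorm_Cauchy_def by meson
  have "seminorm (a *\<^sub>C X m - a *\<^sub>C X n) < e" if "m \<ge> M" "n \<ge> M" for m n
  proof -
    have "seminorm (a *\<^sub>C X m - a *\<^sub>C X n) = cmod a * seminorm (X m - X n)"
      by (simp add: seminorm_simps flip: scaleC_diff_right)
    also have "\<dots> \<le> (cmod a + 1) * seminorm (X m - X n)"
      by (intro mult_right_mono) (auto simp: seminorm_nonneg)
    also have "\<dots> < e" using M that
      by (metis add_nonneg_pos mult.commute norm_ge_zero pos_less_divide_eq zero_less_one)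
    finally show ?thesis .
  qed
  then show "\<exists>M. \<forall>m\<ge>M. \<forall>n\<ge>M. seminorm (a *\<^sub>C X m - a *\<^sub>C X n) < e" by blast
qed

lemma seminorm_diff_abs: "\<bar>seminorm x - seminorm y\<bar> \<le> seminorm (x - y)"
  using seminorm_triangle[of "x - y" y] seminorm_triangle[of "y - x" x]
    seminorm_diff_commute[of x y] by simp

lemma seminorm_Cauchy_convergent:
  assumes "seminorm_Cauchy X" shows "convergent (\<lambda>n. seminorm (X n))"
proof -
  have "Cauchy (\<lambda>n. seminorm (X n))"
    unfolding Cauchy_def dist_real_def
    using assms unfolding seminorm_Cauchy_def by (meson le_less_trans seminorm_diff_abs)
  then show ?thesis by (rule Cauchy_convergent)
qed

lemma seminorm_Cauchy_bounded:
  assumes "seminorm_Cauchy X" obtains B where "B > 0" "\<And>n. seminorm (X n) \<le> B"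
proof -
  from seminorm_Cauchy_convergent[OF assms] have "Bseq (\<lambda>n. seminorm (X n))"
    by (rule convergent_imp_Bseq)
  then obtain K where "K > 0" "\<forall>n. norm (seminorm (X n)) \<le> K" by (rule BseqE)
  then show ?thesis using that by (simp add: seminorm_nonneg)
qed

lemma seminorm_mult_diff:
  "seminorm (x * y - x' * y') \<le> seminorm x * seminorm (y - y') + seminorm (x - x') * seminorm y'"
proof -
  have "x * y - x' * y' = x * (y - y') + (x - x') * y'" by (simp add: algebra_simps)
  then show ?thesis
    using seminorm_triangle[of "x * (y - y')" "(x - x') * y'"] seminorm_mult[of x "y - y'"]
      seminorm_mult[of "x - x'" y'] by simp
qed

lemma seminorm_Cauchy_mult:
  assumes "seminorm_Cauchy X" "seminorm_Cauchy Y"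
  shows "seminorm_Cauchy (\<lambda>n. X n * Y n)"
  unfolding seminorm_Cauchy_def
proof (intro allI impI)
  fix e :: real assume e: "0 < e"
  obtain A where A: "A > 0" "\<And>n. seminorm (X n) \<le> A" using seminorm_Cauchy_bounded[OF assms(1)] by blast
  obtain B where B: "B > 0" "\<And>n. seminorm (Y n) \<le> B" using seminorm_Cauchy_bounded[OF assms(2)] by blast
  have "0 < e / 2 / A" "0 < e / 2 / B" using e A B by auto
  then obtain M N where M: "\<forall>m\<ge>M. \<forall>n\<ge>M. seminorm (X m - X n) < e / 2 / B"
    and N: "\<forall>m\<ge>N. \<forall>n\<ge>N. seminorm (Y m - Y n) < e / 2 / A"
    using assms unfolding seminorm_Cauchy_def by meson
  have "seminorm (X m * Y m - X n * Y n) < e" if "m \<ge> max M N" "n \<ge> max M N" for m n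
  proof -
    have "seminorm (X m) * seminorm (Y m - Y n) \<le> A * seminorm (Y m - Y n)"
      by (intro mult_right_mono A seminorm_nonneg)
    also have "\<dots> < A * (e / 2 / A)" using A N that by (intro mult_strict_left_mono) auto
    finally have 1: "seminorm (X m) * seminorm (Y m - Y n) < e / 2" using A by simp
    have "seminorm (X m - X n) * seminorm (Y n) \<le> seminorm (X m - X n) * B"
      by (intro mult_left_mono B seminorm_nonneg)
    also have "\<dots> < (e / 2 / B) * B" using B M that by (intro mult_strict_right_mono) auto
    finally have 2: "seminorm (X m - X n) * seminorm (Y n) < e / 2" using B by simp
    show ?thesis using seminorm_mult_diff[of "X m" "Y m" "X n" "Y n"] 1 2 by linarith
  qed
  then show "\<exists>M. \<forall>m\<ge>M. \<forall>n\<ge>M. seminorm (X m * Y m - X n * Y n) < e" by blast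
qed

lemma seminorm_equiv_lim:
  assumes "seminorm_equiv X Y"
  shows "lim (\<lambda>n. seminorm (X n)) = lim (\<lambda>n. seminorm (Y n))"
proof -
  from assms have X: "(\<lambda>n. seminorm (X n)) \<longlonglongrightarrow> lim (\<lambda>n. seminorm (X n))"
    by (simp add: seminorm_equiv_def seminorm_Cauchy_convergent flip: convergent_LIMSEQ_iff)
  have 0: "(\<lambda>n. seminorm (X n - Y n)) \<longlonglongrightarrow> 0" using assms by (simp add: seminorm_equiv_def)
  have "(\<lambda>n. seminorm (Y n) - seminorm (X n)) \<longlonglongrightarrow> 0"
    by (rule tendsto_rabs_zero_cancel, rule tendsto_sandwich[OF _ _ tendsto_const 0])
      (auto simp: abs_minus_commute seminorm_diff_abs)
  from tendsto_add[OF this X] show ?thesis by (simp add: limI)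
qed

instantiation cstar_completion :: (cstar_seminormed_algebra) star_algebra
begin
lift_definition zero_cstar_completion :: "'a cstar_completion" is "\<lambda>_. 0"
  by (simp add: seminorm_Cauchy_const)
lift_definition one_cstar_completion :: "'a cstar_completion" is "\<lambda>_. 1"
  by (simp add: seminorm_Cauchy_const)
lift_definition plus_cstar_completion ::
  "'a cstar_completion \<Rightarrow> 'a cstar_completion \<Rightarrow> 'a cstar_completion"
  is "\<lambda>X Y n. X n + Y n"
proof -
  fix X X' Y Y' :: "nat \<Rightarrow> 'a" assume *: "seminorm_equiv X X'" "seminorm_equiv Y Y'"
  have "(\<lambda>n. seminorm (X n - X' n) + seminorm (Y n - Y' n)) \<longlonglongrightarrow> 0"
    using tendsto_add[of "\<lambda>n. seminorm (X n - X' n)" 0 _ "\<lambda>n. seminorm (Y n - Y' n)" 0] *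
    by (simp add: seminorm_equiv_def)
  moreover have "seminorm (X n + Y n - (X' n + Y' n))
      \<le> seminorm (X n - X' n) + seminorm (Y n - Y' n)" for n
    using seminorm_triangle[of "X n - X' n" "Y n - Y' n"] by (simp add: algebra_simps)
  ultimately show "seminorm_equiv (\<lambda>n. X n + Y n) (\<lambda>n. X' n + Y' n)"
    using * by (auto simp: seminorm_equiv_def seminorm_Cauchy_add intro: seminorm_tendsto_0I)
qed
lift_definition uminus_cstar_completion :: "'a cstar_completion \<Rightarrow> 'a cstar_completion"
  is "\<lambda>X n. - X n"
  by (simp add: seminorm_equiv_def seminorm_Cauchy_uminus)
    (metis (no_types, lifting) ext add.commute seminorm_diff_commute uminus_add_conv_diff)
definition minus_cstar_completion ::
  "'a cstar_completion \<Rightarrow> 'a cstar_completion \<Rightarrow> 'a cstar_completion"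
  where "minus_cstar_completion x y = x + - y"
lift_definition times_cstar_completion ::
  "'a cstar_completion \<Rightarrow> 'a cstar_completion \<Rightarrow> 'a cstar_completion"
  is "\<lambda>X Y n. X n * Y n"
proof -
  fix X X' Y Y' :: "nat \<Rightarrow> 'a" assume *: "seminorm_equiv X X'" "seminorm_equiv Y Y'"
  obtain A where A: "A > 0" "\<And>n. seminorm (X n) \<le> A"
    using seminorm_Cauchy_bounded * seminorm_equiv_def by metis
  obtain B where B: "B > 0" "\<And>n. seminorm (Y' n) \<le> B"
    using seminorm_Cauchy_bounded * seminorm_equiv_def by metis
  have "(\<lambda>n. A * seminorm (Y n - Y' n) + seminorm (X n - X' n) * B) \<longlonglongrightarrow> A * 0 + 0 * B"
    using * by (intro tendsto_intros) (auto simp: seminorm_equiv_def)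
  moreover have "seminorm (X n * Y n - X' n * Y' n)
      \<le> A * seminorm (Y n - Y' n) + seminorm (X n - X' n) * B" for n
  proof -
    have "seminorm (X n) * seminorm (Y n - Y' n) \<le> A * seminorm (Y n - Y' n)"
      "seminorm (X n - X' n) * seminorm (Y' n) \<le> seminorm (X n - X' n) * B"
      by (rule mult_right_mono[OF A(2) seminorm_nonneg], rule mult_left_mono[OF B(2) seminorm_nonneg])
    then show ?thesis using seminorm_mult_diff[of "X n" "Y n" "X' n" "Y' n"] by linarith
  qed
  ultimately show "seminorm_equiv (\<lambda>n. X n * Y n) (\<lambda>n. X' n * Y' n)"
    using * by (auto simp: seminorm_equiv_def seminorm_Cauchy_mult intro: seminorm_tendsto_0I)
qed
lift_definition scaleC_cstar_completion :: "complex \<Rightarrow> 'a cstar_completion \<Rightarrow> 'a cstar_completion"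
  is "\<lambda>a X n. a *\<^sub>C X n"
proof -
  fix a :: complex and X X' :: "nat \<Rightarrow> 'a" assume *: "seminorm_equiv X X'"
  have "(\<lambda>n. cmod a * seminorm (X n - X' n)) \<longlonglongrightarrow> 0"
    using * tendsto_mult_right_zero by (auto simp: seminorm_equiv_def)
  then show "seminorm_equiv (\<lambda>n. a *\<^sub>C X n) (\<lambda>n. a *\<^sub>C X' n)"
    using * by (simp add: seminorm_equiv_def seminorm_Cauchy_scaleC seminorm_simps
        flip: scaleC_diff_right)
qed
lift_definition star_cstar_completion :: "'a cstar_completion \<Rightarrow> 'a cstar_completion"
  is "\<lambda>X n. (X n)\<^sup>\<star>"
  by (simp add: seminorm_equiv_def seminorm_Cauchy_star seminorm_simps flip: star_diff)
instance
proof
  fix a b :: complex and x y z :: "'a cstar_completion"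
  note C = seminorm_Cauchy_add seminorm_Cauchy_mult seminorm_Cauchy_scaleC seminorm_Cauchy_star
    seminorm_Cauchy_uminus seminorm_Cauchy_const
  show "x * y * z = x * (y * z)" by transfer (simp add: mult.assoc C)
  show "x + y + z = x + (y + z)" by transfer (simp add: add.assoc C)
  show "x + y = y + x" by transfer (simp add: add.commute C)
  show "0 + x = x" "- x + x = 0" by (transfer, simp add: C)+
  show "x - y = x + - y" by (rule minus_cstar_completion_def)
  show "(x + y) * z = x * z + y * z" by transfer (simp add: distrib_right C)
  show "x * (y + z) = x * y + x * z" by transfer (simp add: distrib_left C)
  show "1 * x = x" "x * 1 = x" by (transfer, simp)+
  show "a *\<^sub>C (x + y) = a *\<^sub>C x + a *\<^sub>C y" by transfer (simp add: scaleC_add_right C)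
  show "(a + b) *\<^sub>C x = a *\<^sub>C x + b *\<^sub>C x" by transfer (simp add: scaleC_add_left C)
  show "a *\<^sub>C b *\<^sub>C x = (a * b) *\<^sub>C x" by transfer (simp add: scaleC_scaleC C)
  show "1 *\<^sub>C x = x" by transfer (simp add: scaleC_one)
  show "(a *\<^sub>C x) * y = a *\<^sub>C (x * y)" by transfer (simp add: mult_scaleC_left C)
  show "x * (a *\<^sub>C y) = a *\<^sub>C (x * y)" by transfer (simp add: mult_scaleC_right C)
  show "x\<^sup>\<star>\<^sup>\<star> = x" by transfer (simp add: star_star)
  show "(x + y)\<^sup>\<star> = x\<^sup>\<star> + y\<^sup>\<star>" by transfer (simp add: star_add C)
  show "(x * y)\<^sup>\<star> = y\<^sup>\<star> * x\<^sup>\<star>" by transfer (simp add: star_mult C)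
  show "(a *\<^sub>C x)\<^sup>\<star> = cnj a *\<^sub>C x\<^sup>\<star>" by transfer (simp add: star_scaleC C)
qed
end

instantiation cstar_completion :: (cstar_seminormed_algebra) real_normed_algebra
begin
definition scaleR_cstar_completion :: "real \<Rightarrow> 'a cstar_completion \<Rightarrow> 'a cstar_completion"
  where "scaleR_cstar_completion r x = complex_of_real r *\<^sub>C x"
lift_definition norm_cstar_completion :: "'a cstar_completion \<Rightarrow> real"
  is "\<lambda>X. lim (\<lambda>n. seminorm (X n))"
  by (rule seminorm_equiv_lim)
definition sgn_cstar_completion :: "'a cstar_completion \<Rightarrow> 'a cstar_completion"
  where "sgn_cstar_completion x = scaleR (inverse (norm x)) x"
definition dist_cstar_completion :: "'a cstar_completion \<Rightarrow> 'a cstar_completion \<Rightarrow> real"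
  where "dist_cstar_completion x y = norm (x - y)"
definition uniformity_cstar_completion :: "('a cstar_completion \<times> 'a cstar_completion) filter"
  where "uniformity_cstar_completion = (INF e\<in>{0 <..}. principal {(x, y). dist x y < e})"
definition open_cstar_completion :: "'a cstar_completion set \<Rightarrow> bool"
  where "open_cstar_completion U \<longleftrightarrow> (\<forall>x\<in>U. \<forall>\<^sub>F (x', y) in uniformity. x' = x \<longrightarrow> y \<in> U)"

lemma norm_completion_tendsto:
  assumes "seminorm_Cauchy X"
  shows "(\<lambda>n. seminorm (X n)) \<longlonglongrightarrow> norm (abs_cstar_completion X)"
  using assms seminorm_Cauchy_convergent[OF assms]
  by (simp add: norm_cstar_completion.abs_eq flip: convergent_LIMSEQ_iff)

lemma completion_cases:
  obtains X where "seminorm_Cauchy X" "x = abs_cstar_completion X"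
  using Quotient_abs_rep[OF Quotient_cstar_completion] Quotient_rep_reflp[OF Quotient_cstar_completion]
  by (metis seminorm_equiv_refl)

instance
proof
  fix a b :: real and x y :: "'a cstar_completion" and U :: "'a cstar_completion set"
  show "sgn x = scaleR (inverse (norm x)) x" by (rule sgn_cstar_completion_def)
  show "dist x y = norm (x - y)" by (rule dist_cstar_completion_def)
  show "uniformity = (INF e\<in>{0 <..}. principal {(x, y::'a cstar_completion). dist x y < e})"
    by (rule uniformity_cstar_completion_def)
  show "open U \<longleftrightarrow> (\<forall>x\<in>U. \<forall>\<^sub>F (x', y) in uniformity. x' = x \<longrightarrow> y \<in> U)"
    by (rule open_cstar_completion_def)
  show "a *\<^sub>R (x + y) = a *\<^sub>R x + a *\<^sub>R y" "(a + b) *\<^sub>R x = a *\<^sub>R x + b *\<^sub>R x"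
    "a *\<^sub>R b *\<^sub>R x = (a * b) *\<^sub>R x" "1 *\<^sub>R x = x"
    "(a *\<^sub>R x) * y = a *\<^sub>R (x * y)" "x * (a *\<^sub>R y) = a *\<^sub>R (x * y)"
    by (simp_all add: scaleR_cstar_completion_def scaleC_add_right scaleC_add_left scaleC_scaleC
        scaleC_one mult_scaleC_left mult_scaleC_right)
  obtain X where X: "seminorm_Cauchy X" "x = abs_cstar_completion X" by (rule completion_cases)
  obtain Y where Y: "seminorm_Cauchy Y" "y = abs_cstar_completion Y" by (rule completion_cases)
  show "norm x = 0 \<longleftrightarrow> x = 0"
  proof
    assume "norm x = 0"
    then have "(\<lambda>n. seminorm (X n)) \<longlonglongrightarrow> 0" using norm_completion_tendsto[OF X(1)] X(2) by simp
    then have "seminorm_equiv X (\<lambda>_. 0)"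
      using X(1) by (simp add: seminorm_equiv_def seminorm_Cauchy_const)
    then show "x = 0"
      unfolding X(2) zero_cstar_completion_def by (rule Quotient_rel_abs[OF Quotient_cstar_completion])
  next
    assume "x = 0"
    then show "norm x = 0"
      using norm_completion_tendsto[OF seminorm_Cauchy_const[of 0]]
      by (simp add: zero_cstar_completion_def seminorm_simps LIMSEQ_const_iff)
  qed
  have lXY: "(\<lambda>n. seminorm (X n) + seminorm (Y n)) \<longlonglongrightarrow> norm x + norm y"
    "(\<lambda>n. seminorm (X n) * seminorm (Y n)) \<longlonglongrightarrow> norm x * norm y"
    using norm_completion_tendsto X Y by (auto intro: tendsto_intros)
  have "(\<lambda>n. seminorm (X n + Y n)) \<longlonglongrightarrow> norm (x + y)"
    using norm_completion_tendsto[OF seminorm_Cauchy_add[OF X(1) Y(1)]] X Y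
    by (simp add: plus_cstar_completion.abs_eq)
  then show "norm (x + y) \<le> norm x + norm y"
    by (rule LIMSEQ_le[OF _ lXY(1)]) (auto simp: seminorm_triangle)
  have "(\<lambda>n. seminorm (X n * Y n)) \<longlonglongrightarrow> norm (x * y)"
    using norm_completion_tendsto[OF seminorm_Cauchy_mult[OF X(1) Y(1)]] X Y
    by (simp add: times_cstar_completion.abs_eq)
  then show "norm (x * y) \<le> norm x * norm y"
    by (rule LIMSEQ_le[OF _ lXY(2)]) (auto simp: seminorm_mult)
  have "(\<lambda>n. seminorm (complex_of_real a *\<^sub>C X n)) \<longlonglongrightarrow> norm (a *\<^sub>R x)"
    using norm_completion_tendsto[OF seminorm_Cauchy_scaleC[OF X(1), of a]] X
    by (simp add: scaleC_cstar_completion.abs_eq scaleR_cstar_completion_def)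
  moreover have "(\<lambda>n. seminorm (complex_of_real a *\<^sub>C X n)) \<longlonglongrightarrow> \<bar>a\<bar> * norm x"
    using tendsto_mult_left[OF norm_completion_tendsto[OF X(1)]] X(2) by (simp add: seminorm_simps)
  ultimately show "norm (a *\<^sub>R x) = \<bar>a\<bar> * norm x"
    by (rule LIMSEQ_unique)
qed
end

lift_definition completion_embed :: "'a::cstar_seminormed_algebra \<Rightarrow> 'a cstar_completion"
  is "\<lambda>x n. x" by (simp add: seminorm_Cauchy_const)

lemma star_homomorphism_completion_embed: "star_homomorphism completion_embed"
  unfolding star_homomorphism_def by (intro conjI allI; transfer) (simp_all add: seminorm_Cauchy_const)

lemma star_homomorphism_comp: "star_homomorphism f \<Longrightarrow> star_homomorphism g \<Longrightarrow> star_homomorphism (g \<circ> f)"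
  by (simp add: star_homomorphism_def)

lemma star_homomorphism_0: "star_homomorphism f \<Longrightarrow> f 0 = 0"
  unfolding star_homomorphism_def by (metis add_cancel_right_right)

lemma star_homomorphism_diff:
  assumes "star_homomorphism f" shows "f (x - y) = f x - f y"
proof -
  have "f (x - y) + f y = f x" using assms unfolding star_homomorphism_def by (metis diff_add_cancel)
  then show ?thesis by (simp add: eq_diff_eq)
qed

lemma norm_completion_embed: "norm (completion_embed x) = seminorm x"
  by transfer (simp add: limI)

lemma norm_completion_embed_diff:
  "norm (completion_embed x - completion_embed y) = seminorm (x - y)"
  by (metis norm_completion_embed star_homomorphism_completion_embed star_homomorphism_diff)

lemma completion_embed_tendsto:
  assumes X: "seminorm_Cauchy X"
  shows "(\<lambda>n. completion_embed (X n)) \<longlonglongrightarrow> abs_cstar_completion X"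
proof (rule LIMSEQ_I)
  fix e :: real assume e: "0 < e"
  then have "0 < e / 2" by simp
  then obtain M where M: "\<forall>m\<ge>M. \<forall>n\<ge>M. seminorm (X m - X n) < e / 2"
    using X unfolding seminorm_Cauchy_def by meson
  have "norm (completion_embed (X m) - abs_cstar_completion X) < e" if "m \<ge> M" for m
  proof -
    have C: "seminorm_Cauchy (\<lambda>n. X m - X n)"
      by (intro seminorm_Cauchy_diff seminorm_Cauchy_const X)
    have "completion_embed (X m) - abs_cstar_completion X = abs_cstar_completion (\<lambda>n. X m - X n)"
      using X by (simp add: minus_cstar_completion_def completion_embed.abs_eq seminorm_Cauchy_const
          seminorm_Cauchy_uminus uminus_cstar_completion.abs_eq plus_cstar_completion.abs_eq)
    with norm_completion_tendsto[OF C]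
    have "(\<lambda>n. seminorm (X m - X n)) \<longlonglongrightarrow> norm (completion_embed (X m) - abs_cstar_completion X)"
      by simp
    then have "norm (completion_embed (X m) - abs_cstar_completion X) \<le> e / 2"
      by (rule LIMSEQ_le_const2) (use M that in \<open>auto intro!: exI[of _ M] less_imp_le\<close>)
    then show ?thesis using e by simp
  qed
  then show "\<exists>N. \<forall>n\<ge>N. norm (completion_embed (X n) - abs_cstar_completion X) < e" by blast
qed

lemma completion_embed_dense:
  assumes "0 < e" obtains x where "dist (completion_embed x) a < e"
proof -
  obtain X where X: "seminorm_Cauchy X" "a = abs_cstar_completion X" by (rule completion_cases)
  from completion_embed_tendsto[OF X(1)] assms show ?thesis
    using that X(2) unfolding lim_sequentially by blast
qed

instance cstar_completion :: (cstar_seminormed_algebra) cstar_algebra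
proof
  fix r :: real and a :: complex and x :: "'a cstar_completion"
  show "r *\<^sub>R x = complex_of_real r *\<^sub>C x" by (rule scaleR_cstar_completion_def)
  obtain X where X: "seminorm_Cauchy X" "x = abs_cstar_completion X" by (rule completion_cases)
  have "(\<lambda>n. seminorm (a *\<^sub>C X n)) \<longlonglongrightarrow> norm (a *\<^sub>C x)"
    using norm_completion_tendsto[OF seminorm_Cauchy_scaleC[OF X(1), of a]] X
    by (simp add: scaleC_cstar_completion.abs_eq)
  moreover have "(\<lambda>n. seminorm (a *\<^sub>C X n)) \<longlonglongrightarrow> cmod a * norm x"
    using tendsto_mult_left[OF norm_completion_tendsto[OF X(1)]] X(2) by (simp add: seminorm_simps)
  ultimately show "norm (a *\<^sub>C x) = cmod a * norm x"
    by (rule LIMSEQ_unique)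
  have "(\<lambda>n. seminorm ((X n)\<^sup>\<star> * X n)) \<longlonglongrightarrow> norm (x\<^sup>\<star> * x)"
    using norm_completion_tendsto[OF seminorm_Cauchy_mult[OF seminorm_Cauchy_star[OF X(1)] X(1)]] X
    by (simp add: star_cstar_completion.abs_eq times_cstar_completion.abs_eq seminorm_Cauchy_star)
  moreover have "(\<lambda>n. seminorm ((X n)\<^sup>\<star> * X n)) \<longlonglongrightarrow> (norm x)\<^sup>2"
    using tendsto_power[OF norm_completion_tendsto[OF X(1)], of 2] X(2) by (simp add: seminorm_star_mult)
  ultimately show "norm (x\<^sup>\<star> * x) = (norm x)\<^sup>2"
    by (rule LIMSEQ_unique)
next
  fix A :: "nat \<Rightarrow> 'a cstar_completion" assume A: "Cauchy A"
  have "\<exists>x. dist (completion_embed x) (A n) < inverse (real (Suc n))" for n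
    by (rule completion_embed_dense[of "inverse (real (Suc n))" "A n"]) auto
  then obtain x where x: "\<And>n. dist (completion_embed (x n)) (A n) < inverse (real (Suc n))"
    by metis
  have d: "(\<lambda>n. dist (completion_embed (x n)) (A n)) \<longlonglongrightarrow> 0"
    by (rule tendsto_sandwich[OF _ _ tendsto_const LIMSEQ_inverse_real_of_nat])
      (intro always_eventually allI zero_le_dist less_imp_le x)+
  have "Cauchy (\<lambda>n. completion_embed (x n))"
  proof (rule metric_CauchyI)
    fix e :: real assume "0 < e"
    then have e: "0 < e / 3" by simp
    obtain M where M: "\<forall>m\<ge>M. \<forall>n\<ge>M. dist (A m) (A n) < e / 3"
      using A e unfolding Cauchy_def by meson
    obtain N where N: "\<forall>n\<ge>N. dist (completion_embed (x n)) (A n) < e / 3"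
      using d e unfolding lim_sequentially by (fastforce simp: dist_real_def)
    have "dist (completion_embed (x m)) (completion_embed (x n)) < e"
      if "m \<ge> max M N" "n \<ge> max M N" for m n
    proof -
      have "dist (completion_embed (x m)) (completion_embed (x n))
        \<le> dist (completion_embed (x m)) (A m) + dist (A m) (A n) + dist (completion_embed (x n)) (A n)"
        using dist_triangle[of "completion_embed (x m)" "completion_embed (x n)" "A m"]
          dist_triangle[of "A m" "completion_embed (x n)" "A n"]
        by (simp add: dist_commute)
      also have "\<dots> < e / 3 + e / 3 + e / 3" using M N that by (intro add_strict_mono) auto
      finally show ?thesis by simp
    qed
    then show "\<exists>M. \<forall>m\<ge>M. \<forall>n\<ge>M. dist (completion_embed (x m)) (completion_embed (x n)) < e"
      by blast
  qed
  then have "seminorm_Cauchy x"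
    by (simp add: Cauchy_def seminorm_Cauchy_def dist_norm norm_completion_embed_diff)
  from completion_embed_tendsto[OF this]
  have l: "(\<lambda>n. completion_embed (x n)) \<longlonglongrightarrow> abs_cstar_completion x" .
  have "A \<longlonglongrightarrow> abs_cstar_completion x"
    by (rule Lim_transform[OF l]) (use d in \<open>simp add: dist_norm tendsto_norm_zero_iff norm_minus_commute\<close>)
  then show "convergent A" by (rule convergentI)
qed


section \<open>The universal unital C*-algebra given by generators and relations\<close>

(*
  A presentation is attached to the type 'g of generators; a pair (l, r) of star-polynomials stands
  for the relation l = r. The C*-seminorms on the free star-algebra vanishing on all l - r are
  exactly the functions norm o h with h a unital star-homomorphism into a unital C*-algebra that
  respects the relations, so the universal C*-algebra is the completion with respect to their
  supremum; see universal_gen_relations and universal_property.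
*)
class presentation =
  fixes relations :: "('a free_star_algebra \<times> 'a free_star_algebra) set"
  assumes relations_bounded:
    "\<exists>M. \<forall>\<rho>. cstar_seminorm \<rho> \<and> (\<forall>(l, r)\<in>relations. \<rho> (l - r) = 0) \<longrightarrow> \<rho> (free_gen g) \<le> M"

definition compatible_seminorms :: "('g::presentation free_star_algebra \<Rightarrow> real) set" where
  "compatible_seminorms = {\<rho>. cstar_seminorm \<rho> \<and> (\<forall>(l, r)\<in>relations. \<rho> (l - r) = 0)}"

lemma compatible_seminorms_nonempty: "(\<lambda>x. 0) \<in> compatible_seminorms"
  by (auto simp: compatible_seminorms_def cstar_seminorm_def)

lemma compatible_cstar_seminorm: "\<rho> \<in> compatible_seminorms \<Longrightarrow> cstar_seminorm \<rho>"
  by (simp add: compatible_seminorms_def)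

lemma compatible_seminorms_bounded: "\<exists>M. \<forall>\<rho>\<in>compatible_seminorms. \<rho> x \<le> M"
proof (induction x rule: free_star_algebra_induct)
  case (1 a x)
  then obtain M where "\<forall>\<rho>\<in>compatible_seminorms. \<rho> x \<le> M" by blast
  then show ?case
    by (intro exI[of _ "cmod a * M"])
      (auto simp: cstar_seminorm_scale[OF compatible_cstar_seminorm] intro!: mult_left_mono)
next
  case (2 x y)
  then obtain M N where "\<forall>\<rho>\<in>compatible_seminorms. \<rho> x \<le> M" "\<forall>\<rho>\<in>compatible_seminorms. \<rho> y \<le> N" by blast
  then have "\<rho> (x + y) \<le> M + N" if "\<rho> \<in> compatible_seminorms" for \<rho>
    using cstar_seminorm_triangle[OF compatible_cstar_seminorm[OF that], of x y] that
    by (meson add_mono order_trans)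
  then show ?case by blast
next
  case 3
  then show ?case using cstar_seminorm_one_le_1[OF compatible_cstar_seminorm] by blast
next
  case (4 x y)
  then obtain M N where "\<forall>\<rho>\<in>compatible_seminorms. \<rho> x \<le> M" "\<forall>\<rho>\<in>compatible_seminorms. \<rho> y \<le> N" by blast
  then have "\<rho> (x * y) \<le> M * N" if "\<rho> \<in> compatible_seminorms" for \<rho>
    using cstar_seminorm_nonneg[OF compatible_cstar_seminorm[OF that]] that
    by (intro order_trans[OF cstar_seminorm_mult[OF compatible_cstar_seminorm[OF that]]] mult_mono)
       (auto intro: order_trans)
  then show ?case by blast
next
  case (5 g)
  then show ?case using relations_bounded[of g] by (auto simp: compatible_seminorms_def)
next
  case (6 x)
  then show ?case by (simp add: cstar_seminorm_star[OF compatible_cstar_seminorm])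
qed

lemma compatible_seminorms_bdd_above: "bdd_above ((\<lambda>\<rho>. \<rho> x) ` compatible_seminorms)"
  using compatible_seminorms_bounded[of x] by (auto simp: bdd_above_def)

instantiation free_star_algebra :: (presentation) cstar_seminormed_algebra
begin
definition seminorm_free_star_algebra :: "'a free_star_algebra \<Rightarrow> real" where
  "seminorm_free_star_algebra x = (SUP \<rho>\<in>compatible_seminorms. \<rho> x)"

lemma compatible_le_seminorm:
  "\<rho> \<in> compatible_seminorms \<Longrightarrow> \<rho> x \<le> seminorm (x :: 'a free_star_algebra)"
  unfolding seminorm_free_star_algebra_def
  by (rule cSUP_upper[OF _ compatible_seminorms_bdd_above])

lemma free_seminorm_least:
  "(\<And>\<rho>. \<rho> \<in> compatible_seminorms \<Longrightarrow> \<rho> x \<le> M) \<Longrightarrow> seminorm (x :: 'a free_star_algebra) \<le> M"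
  unfolding seminorm_free_star_algebra_def
  by (rule cSUP_least) (use compatible_seminorms_nonempty in auto)

lemma cstar_seminorm_free_seminorm: "cstar_seminorm (seminorm :: 'a free_star_algebra \<Rightarrow> real)"
proof -
  have nn: "0 \<le> seminorm (x :: 'a free_star_algebra)" for x
    using compatible_le_seminorm[OF compatible_seminorms_nonempty] by simp
  note cs = compatible_cstar_seminorm
  have sc: "seminorm (a *\<^sub>C x) \<le> cmod a * seminorm x" for a and x :: "'a free_star_algebra"
    by (rule free_seminorm_least)
      (auto simp: cstar_seminorm_scale[OF cs] intro!: mult_left_mono compatible_le_seminorm)
  show ?thesis
    unfolding cstar_seminorm_def
  proof (intro conjI allI)
    fix x y :: "'a free_star_algebra" and a :: complex
    show "seminorm (x + y) \<le> seminorm x + seminorm y"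
      by (rule free_seminorm_least, rule order_trans[OF cstar_seminorm_triangle[OF cs]])
        (auto intro!: add_mono compatible_le_seminorm)
    show "seminorm (x * y) \<le> seminorm x * seminorm y"
      by (rule free_seminorm_least, rule order_trans[OF cstar_seminorm_mult[OF cs]])
        (auto intro!: mult_mono compatible_le_seminorm cstar_seminorm_nonneg[OF cs] nn)
    show "seminorm (a *\<^sub>C x) = cmod a * seminorm x"
    proof (cases "a = 0")
      case True
      then show ?thesis using sc[of 0 x] nn[of 0] by simp
    next
      case False
      have "cmod a * seminorm x = cmod a * seminorm (inverse a *\<^sub>C a *\<^sub>C x)"
        using False by (simp add: scaleC_scaleC scaleC_one)
      also have "\<dots> \<le> cmod a * (cmod (inverse a) * seminorm (a *\<^sub>C x))"
        by (intro mult_left_mono sc) auto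
      also have "\<dots> = seminorm (a *\<^sub>C x)" using False by (simp add: norm_inverse)
      finally show ?thesis using sc[of a x] by simp
    qed
    show "seminorm (x\<^sup>\<star> * x) = (seminorm x)\<^sup>2"
    proof (rule antisym)
      show "seminorm (x\<^sup>\<star> * x) \<le> (seminorm x)\<^sup>2"
        by (rule free_seminorm_least)
          (auto simp: cstar_seminorm_star_mult[OF cs]
            intro!: power_mono compatible_le_seminorm cstar_seminorm_nonneg[OF cs])
      have "\<rho> x \<le> sqrt (seminorm (x\<^sup>\<star> * x))" if "\<rho> \<in> compatible_seminorms" for \<rho>
        using compatible_le_seminorm[OF that, of "x\<^sup>\<star> * x"]
        by (intro real_le_rsqrt) (simp add: cstar_seminorm_star_mult[OF cs[OF that]])
      then have "seminorm x \<le> sqrt (seminorm (x\<^sup>\<star> * x))" by (rule free_seminorm_least)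
      then show "(seminorm x)\<^sup>2 \<le> seminorm (x\<^sup>\<star> * x)"
        using nn by (metis power_mono real_sqrt_pow2)
    qed
  qed
qed

instance
  by standard (use cstar_seminorm_free_seminorm in \<open>auto simp: cstar_seminorm_def\<close>)
end

type_synonym 'g universal_cstar_algebra = "'g free_star_algebra cstar_completion"

definition universal_gen :: "'g::presentation \<Rightarrow> 'g universal_cstar_algebra" where
  "universal_gen g = completion_embed (free_gen g)"

lemma star_homomorphism_free_unique:
  assumes "star_homomorphism h" "star_homomorphism k" "\<And>g. h (free_gen g) = k (free_gen g)"
  shows "h x = k x"
  by (induction x rule: free_star_algebra_induct) (use assms in \<open>auto simp: star_homomorphism_def\<close>)

lemma free_eval_universal_gen: "free_eval universal_gen x = completion_embed x"
  by (rule star_homomorphism_free_unique[OF star_homomorphism_free_eval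
        star_homomorphism_completion_embed]) (simp add: universal_gen_def)

theorem universal_gen_relations:
  assumes "(l, r) \<in> (relations :: ('g::presentation free_star_algebra \<times> _) set)"
  shows "free_eval universal_gen l = free_eval universal_gen r"
proof -
  have "seminorm (l - r) \<le> 0"
    by (rule free_seminorm_least) (use assms in \<open>auto simp: compatible_seminorms_def\<close>)
  then have "norm (completion_embed l - completion_embed r) = 0"
    using norm_ge_zero[of "completion_embed l - completion_embed r"]
    by (simp add: norm_completion_embed_diff)
  then show ?thesis by (simp add: free_eval_universal_gen)
qed

lemma star_homomorphism_universal_unique:
  fixes \<Phi> \<Psi> :: "'g::presentation universal_cstar_algebra \<Rightarrow> 'b::cstar_algebra"
  assumes "star_homomorphism \<Phi>" "continuous_on UNIV \<Phi>" "star_homomorphism \<Psi>" "continuous_on UNIV \<Psi>"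
    and "\<And>g. \<Phi> (universal_gen g) = \<Psi> (universal_gen g)"
  shows "\<Phi> = \<Psi>"
proof
  fix a :: "'g universal_cstar_algebra"
  obtain X where X: "seminorm_Cauchy X" "a = abs_cstar_completion X" by (rule completion_cases)
  have "star_homomorphism (\<Phi> \<circ> completion_embed)" "star_homomorphism (\<Psi> \<circ> completion_embed)"
    using star_homomorphism_comp star_homomorphism_completion_embed assms by blast+
  then have e: "\<Phi> (completion_embed x) = \<Psi> (completion_embed x)" for x
    using star_homomorphism_free_unique[of "\<Phi> \<circ> completion_embed" "\<Psi> \<circ> completion_embed" x] assms(5)
    by (simp add: universal_gen_def)
  have "(\<lambda>n. \<Phi> (completion_embed (X n))) \<longlonglongrightarrow> \<Phi> a" "(\<lambda>n. \<Psi> (completion_embed (X n))) \<longlonglongrightarrow> \<Psi> a"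
    using assms(2,4) completion_embed_tendsto[OF X(1)] X(2)
    by (auto intro: continuous_on_tendsto_compose)
  then show "\<Phi> a = \<Psi> a" unfolding e by (rule LIMSEQ_unique)
qed

theorem universal_property:
  fixes f :: "'g::presentation \<Rightarrow> 'b::cstar_algebra"
  assumes rel: "\<And>l r. (l, r) \<in> relations \<Longrightarrow> free_eval f l = free_eval f r"
  shows "\<exists>!\<Phi>. star_homomorphism \<Phi> \<and> continuous_on UNIV \<Phi> \<and> (\<forall>g. \<Phi> (universal_gen g) = f g)"
proof -
  let ?h = "free_eval f"
  have h: "star_homomorphism ?h" by (rule star_homomorphism_free_eval)
  have h': "?h (x + y) = ?h x + ?h y" "?h (a *\<^sub>C x) = a *\<^sub>C ?h x" "?h (x * y) = ?h x * ?h y"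
    "?h (x\<^sup>\<star>) = (?h x)\<^sup>\<star>" "?h 1 = 1" for x y a
    using h by (simp_all add: star_homomorphism_def)
  have "(\<lambda>x. norm (?h x)) \<in> compatible_seminorms"
    using rel by (auto simp: compatible_seminorms_def cstar_seminorm_def h' norm_triangle_ineq
        norm_scaleC norm_mult_ineq norm_star_mult star_homomorphism_diff[OF h])
  then have le: "norm (?h x) \<le> seminorm x" for x
    using compatible_le_seminorm by blast
  have dle: "dist (?h x) (?h y) \<le> seminorm (x - y)" for x y
    unfolding dist_norm star_homomorphism_diff[OF h, symmetric] by (rule le)
  have conv: "convergent (\<lambda>n. ?h (X n))" if X: "seminorm_Cauchy X" for X
  proof (rule Cauchy_convergent, rule metric_CauchyI)
    fix e :: real assume "0 < e"
    then obtain M where "\<forall>m\<ge>M. \<forall>n\<ge>M. seminorm (X m - X n) < e"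
      using X unfolding seminorm_Cauchy_def by meson
    then show "\<exists>M. \<forall>m\<ge>M. \<forall>n\<ge>M. dist (?h (X m)) (?h (X n)) < e"
      by (meson dle le_less_trans)
  qed
  define \<Phi> where "\<Phi> a = lim (\<lambda>n. ?h (rep_cstar_completion a n))" for a
  have \<Phi>: "(\<lambda>n. ?h (X n)) \<longlonglongrightarrow> \<Phi> (abs_cstar_completion X)" if X: "seminorm_Cauchy X" for X
  proof -
    let ?R = "rep_cstar_completion (abs_cstar_completion X)"
    have eq: "seminorm_equiv ?R X"
      using X rep_abs_rsp_left[OF Quotient3_cstar_completion, of X X] by simp
    then have R: "(\<lambda>n. ?h (?R n)) \<longlonglongrightarrow> \<Phi> (abs_cstar_completion X)"
      unfolding \<Phi>_def using conv[of ?R]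
      by (simp add: seminorm_equiv_def flip: convergent_LIMSEQ_iff)
    have s: "(\<lambda>n. seminorm (?R n - X n)) \<longlonglongrightarrow> 0" using eq by (simp add: seminorm_equiv_def)
    have "(\<lambda>n. ?h (X n) - ?h (?R n)) \<longlonglongrightarrow> 0"
    proof (rule Lim_null_comparison[OF always_eventually s], rule allI)
      fix n show "norm (?h (X n) - ?h (?R n)) \<le> seminorm (?R n - X n)"
        using dle[of "X n" "?R n"] seminorm_diff_commute[of "X n" "?R n"] by (simp add: dist_norm)
    qed
    from tendsto_add[OF this R] show ?thesis by simp
  qed
  have emb: "\<Phi> (completion_embed x) = ?h x" for x
    using LIMSEQ_unique[OF tendsto_const \<Phi>[OF seminorm_Cauchy_const[of x]]]
    by (simp add: completion_embed_def map_fun_def)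
  have embed1: "completion_embed (1 :: 'g free_star_algebra) = 1"
    using star_homomorphism_completion_embed unfolding star_homomorphism_def by blast
  have hom: "star_homomorphism \<Phi>"
    unfolding star_homomorphism_def
  proof (intro conjI allI)
    fix x y :: "'g universal_cstar_algebra" and a :: complex
    obtain X where X: "seminorm_Cauchy X" "x = abs_cstar_completion X" by (rule completion_cases)
    obtain Y where Y: "seminorm_Cauchy Y" "y = abs_cstar_completion Y" by (rule completion_cases)
    note lims = \<Phi>[OF X(1), folded X(2)] \<Phi>[OF Y(1), folded Y(2)]
    show "\<Phi> (x + y) = \<Phi> x + \<Phi> y"
      using LIMSEQ_unique[OF \<Phi>[OF seminorm_Cauchy_add[OF X(1) Y(1)], unfolded h'] tendsto_add[OF lims]] X Y
      by (simp add: plus_cstar_completion.abs_eq)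
    show "\<Phi> (x * y) = \<Phi> x * \<Phi> y"
      using LIMSEQ_unique[OF \<Phi>[OF seminorm_Cauchy_mult[OF X(1) Y(1)], unfolded h'] tendsto_mult[OF lims]] X Y
      by (simp add: times_cstar_completion.abs_eq)
    have 1: "(\<lambda>n. a *\<^sub>C ?h (X n)) \<longlonglongrightarrow> a *\<^sub>C \<Phi> x"
    proof -
      have "(\<lambda>n. cmod a * norm (?h (X n) - \<Phi> x)) \<longlonglongrightarrow> 0"
        by (rule tendsto_mult_right_zero[OF tendsto_norm_zero[OF LIM_zero[OF lims(1)]]])
      then have "(\<lambda>n. norm (a *\<^sub>C ?h (X n) - a *\<^sub>C \<Phi> x)) \<longlonglongrightarrow> 0"
        by (simp only: norm_scaleC scaleC_diff_right[symmetric])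
      then show ?thesis by (rule LIM_zero_cancel[OF tendsto_norm_zero_cancel])
    qed
    show "\<Phi> (a *\<^sub>C x) = a *\<^sub>C \<Phi> x"
      using LIMSEQ_unique[OF \<Phi>[OF seminorm_Cauchy_scaleC[OF X(1), of a], unfolded h'] 1] X
      by (simp add: scaleC_cstar_completion.abs_eq)
    have nstar: "norm (b\<^sup>\<star>) = norm b" for b :: 'b
    proof (rule cstar_seminorm_star)
      show "cstar_seminorm (norm :: 'b \<Rightarrow> real)"
        by (simp add: cstar_seminorm_def norm_triangle_ineq norm_scaleC norm_mult_ineq norm_star_mult)
    qed
    have 2: "(\<lambda>n. (?h (X n))\<^sup>\<star>) \<longlonglongrightarrow> (\<Phi> x)\<^sup>\<star>"
    proof -
      have "(\<lambda>n. norm (?h (X n) - \<Phi> x)) \<longlonglongrightarrow> 0"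
        by (rule tendsto_norm_zero[OF LIM_zero[OF lims(1)]])
      then have "(\<lambda>n. norm ((?h (X n))\<^sup>\<star> - (\<Phi> x)\<^sup>\<star>)) \<longlonglongrightarrow> 0"
        by (simp only: nstar star_diff[symmetric])
      then show ?thesis by (rule LIM_zero_cancel[OF tendsto_norm_zero_cancel])
    qed
    show "\<Phi> (x\<^sup>\<star>) = (\<Phi> x)\<^sup>\<star>"
      using LIMSEQ_unique[OF \<Phi>[OF seminorm_Cauchy_star[OF X(1)], unfolded h'] 2] X
      by (simp add: star_cstar_completion.abs_eq)
    show "\<Phi> 1 = 1"
      using emb[of 1] embed1 h'(5) by simp
  qed
  have contr: "norm (\<Phi> x) \<le> norm x" for x
  proof -
    obtain X where X: "seminorm_Cauchy X" "x = abs_cstar_completion X" by (rule completion_cases)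
    show ?thesis
      by (rule LIMSEQ_le[OF tendsto_norm[OF \<Phi>[OF X(1), folded X(2)]]
            norm_completion_tendsto[OF X(1), folded X(2)]]) (use le in auto)
  qed
  have cont: "continuous_on UNIV \<Phi>"
    unfolding continuous_on_iff
  proof (intro ballI allI impI)
    fix x :: "'g universal_cstar_algebra" and e :: real assume "0 < e"
    moreover have "dist (\<Phi> y) (\<Phi> x) \<le> dist y x" for y
      unfolding dist_norm star_homomorphism_diff[OF hom, symmetric] by (rule contr)
    ultimately show "\<exists>d>0. \<forall>y\<in>UNIV. dist y x < d \<longrightarrow> dist (\<Phi> y) (\<Phi> x) < e"
      by (meson le_less_trans)
  qed
  have gen: "\<forall>g. \<Phi> (universal_gen g) = f g" by (simp add: universal_gen_def emb)
  show ?thesis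
    using hom cont gen by (intro ex1I[of _ \<Phi>]) (auto intro!: star_homomorphism_universal_unique)
qed


section \<open>Right LCM semigroups and their boundary quotients\<close>

definition (in monoid_mult) principal_right_ideal :: "'a \<Rightarrow> 'a set" where
  "principal_right_ideal p = {p * q | q. True}"

class right_lcm_monoid = countable + monoid_mult +
  assumes left_cancel: "p * q = p * s \<Longrightarrow> q = s"
    and principal_right_ideals_Int: "principal_right_ideal p \<inter> principal_right_ideal q = {} \<or>
      (\<exists>r. principal_right_ideal p \<inter> principal_right_ideal q = principal_right_ideal r)"

definition invertible_elements :: "'p::monoid_mult set" where
  "invertible_elements = {u. \<exists>v. u * v = 1 \<and> v * u = 1}"

inductive_set constructible_ideals :: "'p::monoid_mult set set" where
  full: "UNIV \<in> constructible_ideals"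
| empty: "{} \<in> constructible_ideals"
| Int: "X \<in> constructible_ideals \<Longrightarrow> Y \<in> constructible_ideals \<Longrightarrow> X \<inter> Y \<in> constructible_ideals"
| translate: "X \<in> constructible_ideals \<Longrightarrow> {p * x | x. x \<in> X} \<in> constructible_ideals"
| preimage: "X \<in> constructible_ideals \<Longrightarrow> {y. p * y \<in> X} \<in> constructible_ideals"

typedef (overloaded) 'p constructible_ideal = "constructible_ideals :: 'p::monoid_mult set set"
  using constructible_ideals.full by blast

setup_lifting type_definition_constructible_ideal

lift_definition full_ideal :: "'p::monoid_mult constructible_ideal" is UNIV
  by (rule constructible_ideals.full)

lift_definition empty_ideal :: "'p::monoid_mult constructible_ideal" is "{}"
  by (rule constructible_ideals.empty)

lift_definition ideal_Int ::
  "'p::monoid_mult constructible_ideal \<Rightarrow> 'p constructible_ideal \<Rightarrow> 'p constructible_ideal"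
  is "(\<inter>)" by (rule constructible_ideals.Int)

lift_definition ideal_translate ::
  "'p::monoid_mult \<Rightarrow> 'p constructible_ideal \<Rightarrow> 'p constructible_ideal"
  is "\<lambda>p X. {p * x | x. x \<in> X}" by (rule constructible_ideals.translate)

lift_definition principal_constructible :: "'p::monoid_mult \<Rightarrow> 'p constructible_ideal"
  is principal_right_ideal
  unfolding principal_right_ideal_def
  using constructible_ideals.translate[OF constructible_ideals.full] by simp

definition foundation_set :: "'p::monoid_mult set \<Rightarrow> bool" where
  "foundation_set F \<longleftrightarrow> finite F \<and>
     (\<forall>p. \<exists>f\<in>F. principal_right_ideal f \<inter> principal_right_ideal p \<noteq> {})"

(*
  Relations are collected as pairs (l, r) standing for l = r, for families in an arbitrary
  star-algebra: in the free star-algebra they are the defining relations, in a C*-algebra the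
  equations to be satisfied. Since the e X need not commute in the free star-algebra, products
  (and below, joins) over a finite set are taken along all enumerations of it.
*)
inductive_set semigroup_equations ::
  "('p::monoid_mult \<Rightarrow> 'a::star_algebra) \<Rightarrow> ('p constructible_ideal \<Rightarrow> 'a) \<Rightarrow> ('a \<times> 'a) set"
  for v e where
  isometry: "((v p)\<^sup>\<star> * v p, 1) \<in> semigroup_equations v e"
| selfadjoint: "((e X)\<^sup>\<star>, e X) \<in> semigroup_equations v e"
| idempotent: "(e X * e X, e X) \<in> semigroup_equations v e"
| L1: "(v p * v q, v (p * q)) \<in> semigroup_equations v e"
| L2: "(v p * e X * (v p)\<^sup>\<star>, e (ideal_translate p X)) \<in> semigroup_equations v e"
| L3_full: "(e full_ideal, 1) \<in> semigroup_equations v e"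
| L3_empty: "(e empty_ideal, 0) \<in> semigroup_equations v e"
| L4: "(e X * e Y, e (ideal_Int X Y)) \<in> semigroup_equations v e"

inductive_set boundary_equations ::
  "('p::monoid_mult \<Rightarrow> 'a::star_algebra) \<Rightarrow> ('p constructible_ideal \<Rightarrow> 'a) \<Rightarrow> ('a \<times> 'a) set"
  for v e where
  semigroup: "(l, r) \<in> semigroup_equations v e \<Longrightarrow> (l, r) \<in> boundary_equations v e"
| foundation: "distinct ps \<Longrightarrow> foundation_set (set ps) \<Longrightarrow>
    (prod_list (map (\<lambda>p. 1 - e (principal_constructible p)) ps), 0) \<in> boundary_equations v e"

declare [[typedef_overloaded]]

datatype 'p boundary_generator = Isometry 'p | Projection "'p constructible_ideal"

lemma boundary_generator_all: "(\<forall>g. P g) \<longleftrightarrow> (\<forall>p. P (Isometry p)) \<and> (\<forall>X. P (Projection X))"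
  by (metis boundary_generator.exhaust)

instantiation boundary_generator :: (monoid_mult) presentation
begin
definition relations_boundary_generator ::
  "('a boundary_generator free_star_algebra \<times> 'a boundary_generator free_star_algebra) set" where
  "relations_boundary_generator =
     boundary_equations (\<lambda>p. free_gen (Isometry p)) (\<lambda>X. free_gen (Projection X))"
instance
proof
  fix g :: "'a boundary_generator"
  have "\<rho> (free_gen g) \<le> 1"
    if \<rho>: "cstar_seminorm \<rho>"
      and rel: "\<forall>(l, r)\<in>(relations :: ('a boundary_generator free_star_algebra \<times> _) set). \<rho> (l - r) = 0"
    for \<rho> :: "'a boundary_generator free_star_algebra \<Rightarrow> real"
  proof -
    have eq0: "\<rho> (l - r) = 0" if "(l, r) \<in> semigroup_equations (\<lambda>p. free_gen (Isometry p))
        (\<lambda>X. free_gen (Projection X) :: 'a boundary_generator free_star_algebra)" for l r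
    proof -
      have "(l, r) \<in> relations"
        unfolding relations_boundary_generator_def using that by (rule boundary_equations.semigroup)
      with rel show ?thesis by blast
    qed
    show ?thesis
    proof (cases g)
      case (Isometry p)
      have "(\<rho> (free_gen g))\<^sup>2 \<le> 1"
        using cstar_seminorm_eq[OF \<rho> eq0[OF semigroup_equations.isometry[of _ p]]] cstar_seminorm_one_le_1[OF \<rho>]
        by (simp add: Isometry cstar_seminorm_star_mult[OF \<rho>])
      then show ?thesis by (simp add: power_le_one_iff cstar_seminorm_nonneg[OF \<rho>])
    next
      case (Projection X)
      let ?e = "free_gen (Projection X) :: 'a boundary_generator free_star_algebra"
      have "\<rho> (?e\<^sup>\<star> - ?e) = 0" "\<rho> (?e * ?e - ?e) = 0"
        using eq0[OF semigroup_equations.selfadjoint[of _ X]]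
          eq0[OF semigroup_equations.idempotent[of _ X]] by auto
      moreover have "\<rho> (?e\<^sup>\<star> * ?e - ?e) \<le> \<rho> (?e\<^sup>\<star> * ?e - ?e * ?e) + \<rho> (?e * ?e - ?e)"
        by (rule cstar_seminorm_diff_triangle[OF \<rho>])
      moreover have "\<rho> (?e\<^sup>\<star> * ?e - ?e * ?e) \<le> \<rho> (?e\<^sup>\<star> - ?e) * \<rho> ?e"
        using cstar_seminorm_mult[OF \<rho>, of "?e\<^sup>\<star> - ?e" ?e] by (simp add: algebra_simps)
      ultimately have "\<rho> (?e\<^sup>\<star> * ?e - ?e) = 0"
        using cstar_seminorm_nonneg[OF \<rho>, of "?e\<^sup>\<star> * ?e - ?e"] by simp
      then show ?thesis unfolding Projection by (rule cstar_seminorm_projection_le_1[OF \<rho>])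
    qed
  qed
  then show "\<exists>M. \<forall>\<rho>. cstar_seminorm \<rho> \<and>
      (\<forall>(l, r)\<in>(relations :: ('a boundary_generator free_star_algebra \<times> _) set). \<rho> (l - r) = 0)
      \<longrightarrow> \<rho> (free_gen g) \<le> M" by blast
qed
end

type_synonym 'p boundary_quotient = "'p boundary_generator universal_cstar_algebra"

definition boundary_v :: "'p::monoid_mult \<Rightarrow> 'p boundary_quotient" where
  "boundary_v p = universal_gen (Isometry p)"

definition boundary_e :: "'p::monoid_mult constructible_ideal \<Rightarrow> 'p boundary_quotient" where
  "boundary_e X = universal_gen (Projection X)"

lemma star_homomorphism_one: "star_homomorphism h \<Longrightarrow> h 1 = 1"
  and star_homomorphism_add: "star_homomorphism h \<Longrightarrow> h (x + y) = h x + h y"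
  and star_homomorphism_mult: "star_homomorphism h \<Longrightarrow> h (x * y) = h x * h y"
  and star_homomorphism_star: "star_homomorphism h \<Longrightarrow> h (x\<^sup>\<star>) = (h x)\<^sup>\<star>"
  by (simp_all add: star_homomorphism_def)

lemmas star_homomorphism_simps = star_homomorphism_0 star_homomorphism_one star_homomorphism_add
  star_homomorphism_diff star_homomorphism_mult star_homomorphism_star

lemma star_homomorphism_prod_list:
  "star_homomorphism h \<Longrightarrow> h (prod_list xs) = prod_list (map h xs)"
  by (induction xs) (simp_all add: star_homomorphism_simps)

lemma boundary_equations_image:
  assumes h: "star_homomorphism h"
  shows "map_prod h h ` boundary_equations v e = boundary_equations (\<lambda>p. h (v p)) (\<lambda>X. h (e X))"
    (is "?L = ?R")
proof
  note H = star_homomorphism_simps[OF h] star_homomorphism_prod_list[OF h]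
  have sg: "(h l, h r) \<in> semigroup_equations (\<lambda>p. h (v p)) (\<lambda>X. h (e X))"
    if "(l, r) \<in> semigroup_equations v e" for l r
    using that
    by cases (simp_all add: H
        semigroup_equations.intros[where v = "\<lambda>p. h (v p)" and e = "\<lambda>X. h (e X)"])
  show "?L \<subseteq> ?R"
  proof (intro image_subsetI)
    fix lr assume "lr \<in> boundary_equations v e"
    moreover obtain l r where lr: "lr = (l, r)" by fastforce
    ultimately have "(l, r) \<in> boundary_equations v e" by simp
    then have "map_prod h h (l, r) \<in> ?R"
    proof cases
      case (foundation ps)
      then show ?thesis
        using boundary_equations.foundation[of ps "\<lambda>X. h (e X)" "\<lambda>p. h (v p)"]
        by (simp add: H o_def)
    qed (simp add: boundary_equations.semigroup sg)
    then show "map_prod h h lr \<in> ?R" unfolding lr .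
  qed
  have sg': "(l, r) \<in> map_prod h h ` semigroup_equations v e"
    if "(l, r) \<in> semigroup_equations (\<lambda>p. h (v p)) (\<lambda>X. h (e X))" for l r
    using that
  proof cases
    case (isometry p)
    then show ?thesis by (intro image_eqI[OF _ semigroup_equations.isometry[of v p e]]) (simp add: H)
  next
    case (selfadjoint X)
    then show ?thesis by (intro image_eqI[OF _ semigroup_equations.selfadjoint[of e X v]]) (simp add: H)
  next
    case (idempotent X)
    then show ?thesis by (intro image_eqI[OF _ semigroup_equations.idempotent[of e X v]]) (simp add: H)
  next
    case (L1 p q)
    then show ?thesis by (intro image_eqI[OF _ semigroup_equations.L1[of v p q e]]) (simp add: H)
  next
    case (L2 p X)
    then show ?thesis by (intro image_eqI[OF _ semigroup_equations.L2[of v p e X]]) (simp add: H)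
  next
    case L3_full
    then show ?thesis by (intro image_eqI[OF _ semigroup_equations.L3_full[of e v]]) (simp add: H)
  next
    case L3_empty
    then show ?thesis by (intro image_eqI[OF _ semigroup_equations.L3_empty[of e v]]) (simp add: H)
  next
    case (L4 X Y)
    then show ?thesis by (intro image_eqI[OF _ semigroup_equations.L4[of e X Y v]]) (simp add: H)
  qed
  show "?R \<subseteq> ?L"
  proof (rule subrelI)
    fix l r assume "(l, r) \<in> ?R"
    then show "(l, r) \<in> ?L"
    proof cases
      case semigroup
      then obtain l' r' where "(l', r') \<in> semigroup_equations v e" "l = h l'" "r = h r'"
        using sg'[OF semigroup] by auto
      then show ?thesis by (intro image_eqI[OF _ boundary_equations.semigroup[of l' r']]) auto
    next
      case (foundation ps)
      then show ?thesis
        by (intro image_eqI[OF _ boundary_equations.foundation[of ps e v]]) (simp_all add: H o_def)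
    qed
  qed
qed

theorem boundary_quotient_relations:
  assumes "(l, r) \<in> boundary_equations boundary_v boundary_e" shows "l = r"
proof -
  have "boundary_equations boundary_v boundary_e = map_prod (free_eval universal_gen)
      (free_eval universal_gen) ` (relations :: ('a boundary_generator free_star_algebra \<times> _) set)"
    unfolding relations_boundary_generator_def
    by (subst boundary_equations_image[OF star_homomorphism_free_eval])
      (simp add: boundary_v_def[abs_def] boundary_e_def[abs_def])
  with assms obtain l' r' where "(l', r') \<in> (relations :: ('a boundary_generator free_star_algebra \<times> _) set)"
    "l = free_eval universal_gen l'" "r = free_eval universal_gen r'" by auto
  then show ?thesis using universal_gen_relations[of l' r'] by simp
qed

theorem boundary_quotient_universal:
  fixes v :: "'p::monoid_mult \<Rightarrow> 'b::cstar_algebra"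
  assumes "\<And>l r. (l, r) \<in> boundary_equations v e \<Longrightarrow> l = r"
  shows "\<exists>!\<Phi>. star_homomorphism \<Phi> \<and> continuous_on UNIV \<Phi> \<and>
    (\<forall>p. \<Phi> (boundary_v p) = v p) \<and> (\<forall>X. \<Phi> (boundary_e X) = e X)"
proof -
  define f where "f g = (case g of Isometry p \<Rightarrow> v p | Projection X \<Rightarrow> e X)" for g
  have im: "map_prod (free_eval f) (free_eval f) ` relations = boundary_equations v e"
    unfolding relations_boundary_generator_def
    by (subst boundary_equations_image[OF star_homomorphism_free_eval]) (simp add: f_def)
  have "free_eval f l = free_eval f r" if lr: "(l, r) \<in> relations" for l r
  proof -
    have "(free_eval f l, free_eval f r) \<in> boundary_equations v e"
      unfolding im[symmetric] using lr by force
    then show ?thesis by (rule assms)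
  qed
  from universal_property[of f, OF this] show ?thesis
    unfolding boundary_generator_all by (simp add: boundary_v_def boundary_e_def f_def)
qed


section \<open>Inverse semigroups with zero and their tight C*-algebras\<close>

class inverse_semigroup_zero = semigroup_mult + mult_zero + star +
  assumes mult_star_mult: "s * s\<^sup>\<star> * s = s"
    and star_mult_star: "s\<^sup>\<star> * s * s\<^sup>\<star> = s\<^sup>\<star>"
    and inverse_unique: "s * t * s = s \<Longrightarrow> t * s * t = t \<Longrightarrow> t = s\<^sup>\<star>"

definition idempotents :: "'s::inverse_semigroup_zero set" where
  "idempotents = {e. e * e = e}"

definition idempotents_between ::
  "'s::inverse_semigroup_zero set \<Rightarrow> 's set \<Rightarrow> 's set" where
  "idempotents_between X Y = {e \<in> idempotents. (\<forall>x\<in>X. e * x = e) \<and> (\<forall>y\<in>Y. e * y = 0)}"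

definition is_cover :: "'s::inverse_semigroup_zero set \<Rightarrow> 's set \<Rightarrow> bool" where
  "is_cover F Z \<longleftrightarrow> F \<subseteq> Z \<and> (\<forall>z\<in>Z. z \<noteq> 0 \<longrightarrow> (\<exists>f\<in>F. f * z \<noteq> 0))"

primrec join_list :: "'a::star_algebra list \<Rightarrow> 'a" where
  "join_list [] = 0"
| "join_list (x # xs) = x + join_list xs - x * join_list xs"

inductive_set tight_equations :: "('s::inverse_semigroup_zero \<Rightarrow> 'a::star_algebra) \<Rightarrow> ('a \<times> 'a) set"
  for \<pi> where
  mult: "(\<pi> (s * t), \<pi> s * \<pi> t) \<in> tight_equations \<pi>"
| star: "(\<pi> (s\<^sup>\<star>), (\<pi> s)\<^sup>\<star>) \<in> tight_equations \<pi>"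
| zero: "(\<pi> 0, 0) \<in> tight_equations \<pi>"
| tight: "distinct xs \<Longrightarrow> distinct ys \<Longrightarrow> distinct zs \<Longrightarrow>
    set xs \<subseteq> idempotents \<Longrightarrow> set ys \<subseteq> idempotents \<Longrightarrow>
    is_cover (set zs) (idempotents_between (set xs) (set ys)) \<Longrightarrow>
    (join_list (map \<pi> zs), prod_list (map \<pi> xs) * prod_list (map (\<lambda>y. 1 - \<pi> y) ys))
      \<in> tight_equations \<pi>"

definition tight_representation :: "('s::inverse_semigroup_zero \<Rightarrow> 'a::cstar_algebra) \<Rightarrow> bool" where
  "tight_representation \<pi> \<longleftrightarrow> (\<forall>(l, r)\<in>tight_equations \<pi>. l = r)"

datatype 's tight_generator = Tight 's

lemma tight_generator_all: "(\<forall>g. P g) \<longleftrightarrow> (\<forall>s. P (Tight s))"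
  by (metis tight_generator.exhaust)

instantiation tight_generator :: (inverse_semigroup_zero) presentation
begin
definition relations_tight_generator ::
  "('a tight_generator free_star_algebra \<times> 'a tight_generator free_star_algebra) set" where
  "relations_tight_generator = tight_equations (\<lambda>s. free_gen (Tight s))"
instance
proof
  fix g :: "'a tight_generator"
  obtain s where g: "g = Tight s" by (cases g)
  have "\<rho> (free_gen g) \<le> 1"
    if \<rho>: "cstar_seminorm \<rho>"
      and rel: "\<forall>(l, r)\<in>(relations :: ('a tight_generator free_star_algebra \<times> _) set). \<rho> (l - r) = 0"
    for \<rho> :: "'a tight_generator free_star_algebra \<Rightarrow> real"
  proof -
    let ?g = "\<lambda>s. free_gen (Tight s) :: 'a tight_generator free_star_algebra"
    have eq0: "\<rho> (l - r) = 0" if "(l, r) \<in> tight_equations ?g" for l r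
      using rel that by (auto simp: relations_tight_generator_def)
    have star_mult_eq: "\<rho> (?g (t\<^sup>\<star> * t) - (?g t)\<^sup>\<star> * ?g t) = 0" for t
    proof -
      have "\<rho> (?g (t\<^sup>\<star> * t) - (?g t)\<^sup>\<star> * ?g t)
          \<le> \<rho> (?g (t\<^sup>\<star> * t) - ?g (t\<^sup>\<star>) * ?g t) + \<rho> (?g (t\<^sup>\<star>) * ?g t - (?g t)\<^sup>\<star> * ?g t)"
        by (rule cstar_seminorm_diff_triangle[OF \<rho>])
      moreover have "\<rho> (?g (t\<^sup>\<star>) * ?g t - (?g t)\<^sup>\<star> * ?g t) \<le> \<rho> (?g (t\<^sup>\<star>) - (?g t)\<^sup>\<star>) * \<rho> (?g t)"
        using cstar_seminorm_mult[OF \<rho>, of "?g (t\<^sup>\<star>) - (?g t)\<^sup>\<star>" "?g t"] by (simp add: algebra_simps)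
      ultimately show ?thesis
        using eq0[OF tight_equations.mult] eq0[OF tight_equations.star]
          cstar_seminorm_nonneg[OF \<rho>, of "?g (t\<^sup>\<star> * t) - (?g t)\<^sup>\<star> * ?g t"] by simp
    qed
    let ?e = "s\<^sup>\<star> * s"
    have idem: "?e * ?e = ?e" by (metis mult.assoc mult_star_mult)
    have "?e = ?e\<^sup>\<star>" by (rule inverse_unique) (simp_all add: idem)
    then have "\<rho> (?g ?e - (?g ?e)\<^sup>\<star> * ?g ?e) = 0"
      using star_mult_eq[of ?e] idem by simp
    then have e: "\<rho> (?g ?e) \<le> 1"
      using cstar_seminorm_projection_le_1[OF \<rho>, of "?g ?e"] cstar_seminorm_diff_commute[OF \<rho>]
      by simp
    have "(\<rho> (?g s))\<^sup>2 \<le> 1"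
      using e cstar_seminorm_eq[OF \<rho> star_mult_eq[of s]] by (simp add: cstar_seminorm_star_mult[OF \<rho>])
    then show ?thesis by (simp add: g power_le_one_iff cstar_seminorm_nonneg[OF \<rho>])
  qed
  then show "\<exists>M. \<forall>\<rho>. cstar_seminorm \<rho> \<and>
      (\<forall>(l, r)\<in>(relations :: ('a tight_generator free_star_algebra \<times> _) set). \<rho> (l - r) = 0)
      \<longrightarrow> \<rho> (free_gen g) \<le> M" by blast
qed
end

type_synonym 's tight_cstar_algebra = "'s tight_generator universal_cstar_algebra"

definition universal_tight :: "'s::inverse_semigroup_zero \<Rightarrow> 's tight_cstar_algebra" where
  "universal_tight s = universal_gen (Tight s)"

lemma star_homomorphism_join_list:
  "star_homomorphism h \<Longrightarrow> h (join_list xs) = join_list (map h xs)"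
  by (induction xs) (simp_all add: star_homomorphism_simps)

lemma tight_equations_image:
  assumes h: "star_homomorphism h"
  shows "map_prod h h ` tight_equations \<pi> = tight_equations (\<lambda>s. h (\<pi> s))" (is "?L = ?R")
proof
  note H = star_homomorphism_simps[OF h] star_homomorphism_prod_list[OF h]
    star_homomorphism_join_list[OF h] o_def
  show "?L \<subseteq> ?R"
  proof (intro image_subsetI)
    fix lr assume "lr \<in> tight_equations \<pi>"
    moreover obtain l r where lr: "lr = (l, r)" by fastforce
    ultimately have "(l, r) \<in> tight_equations \<pi>" by simp
    then have "map_prod h h (l, r) \<in> ?R"
    proof cases
      case (tight xs ys zs)
      then show ?thesis using tight_equations.tight[of xs ys zs "\<lambda>s. h (\<pi> s)"] by (simp add: H)
    qed (simp_all add: H tight_equations.intros[where \<pi> = "\<lambda>s. h (\<pi> s)"])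
    then show "map_prod h h lr \<in> ?R" unfolding lr .
  qed
  show "?R \<subseteq> ?L"
  proof (rule subrelI)
    fix l r assume "(l, r) \<in> ?R"
    then show "(l, r) \<in> ?L"
    proof cases
      case (mult s t)
      then show ?thesis by (intro image_eqI[OF _ tight_equations.mult[of \<pi> s t]]) (simp add: H)
    next
      case (star s)
      then show ?thesis by (intro image_eqI[OF _ tight_equations.star[of \<pi> s]]) (simp add: H)
    next
      case zero
      then show ?thesis by (intro image_eqI[OF _ tight_equations.zero[of \<pi>]]) (simp add: H)
    next
      case (tight xs ys zs)
      then show ?thesis
        by (intro image_eqI[OF _ tight_equations.tight[of xs ys zs \<pi>]]) (simp_all add: H)
    qed
  qed
qed

theorem tight_representation_universal_tight: "tight_representation universal_tight"
proof -
  have "tight_equations universal_tight = map_prod (free_eval universal_gen)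
      (free_eval universal_gen) ` (relations :: ('a tight_generator free_star_algebra \<times> _) set)"
    unfolding relations_tight_generator_def
    by (subst tight_equations_image[OF star_homomorphism_free_eval])
      (simp add: universal_tight_def[abs_def])
  then show ?thesis using universal_gen_relations by (auto simp: tight_representation_def)
qed

theorem universal_tight_universal:
  fixes \<pi> :: "'s::inverse_semigroup_zero \<Rightarrow> 'b::cstar_algebra"
  assumes "tight_representation \<pi>"
  shows "\<exists>!\<Phi>. star_homomorphism \<Phi> \<and> continuous_on UNIV \<Phi> \<and> (\<forall>s. \<Phi> (universal_tight s) = \<pi> s)"
proof -
  define f where "f g = (case g of Tight s \<Rightarrow> \<pi> s)" for g
  have im: "map_prod (free_eval f) (free_eval f) ` relations = tight_equations \<pi>"
    unfolding relations_tight_generator_def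
    by (subst tight_equations_image[OF star_homomorphism_free_eval]) (simp add: f_def)
  have "free_eval f l = free_eval f r" if lr: "(l, r) \<in> relations" for l r
  proof -
    have "(free_eval f l, free_eval f r) \<in> tight_equations \<pi>"
      unfolding im[symmetric] using lr by force
    then show ?thesis using assms by (auto simp: tight_representation_def)
  qed
  from universal_property[of f, OF this] show ?thesis
    unfolding tight_generator_all by (simp add: universal_tight_def f_def)
qed


section \<open>The inverse semigroup of a right LCM semigroup\<close>

lemma principal_right_ideal_iff: "y \<in> principal_right_ideal p \<longleftrightarrow> (\<exists>x. y = p * x)"
  by (auto simp: principal_right_ideal_def)

lemma principal_right_ideal_Int:
  fixes p q :: "'p::right_lcm_monoid"
  assumes "principal_right_ideal p \<inter> principal_right_ideal q \<noteq> {}"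
  obtains r where "principal_right_ideal p \<inter> principal_right_ideal q = principal_right_ideal r"
  using principal_right_ideals_Int[of p q] assms by blast

fun pair_equiv :: "'p::right_lcm_monoid \<times> 'p \<Rightarrow> 'p \<times> 'p \<Rightarrow> bool" where
  "pair_equiv (p, q) (a, b) \<longleftrightarrow> (\<exists>u\<in>invertible_elements. a * u = p \<and> b * u = q)"

lemma equivp_pair_equiv: "equivp (pair_equiv :: 'p::right_lcm_monoid \<times> 'p \<Rightarrow> _)"
proof (rule equivpI)
  have "(1::'p) \<in> invertible_elements" by (simp add: invertible_elements_def)
  then have "pair_equiv x x" for x :: "'p \<times> 'p"
    by (cases x) (auto intro!: bexI[of _ 1])
  then show "reflp (pair_equiv :: 'p \<times> 'p \<Rightarrow> _)" by (auto intro: reflpI)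
  have "pair_equiv (a, b) (p, q)" if pq: "pair_equiv (p, q) (a, b)" for p q a b :: 'p
  proof -
    obtain u v where "a * u = p" "b * u = q" "u * v = 1" "v * u = 1"
      using pq by (auto simp: invertible_elements_def)
    then have "p * v = a" "q * v = b" "v \<in> invertible_elements"
      by (auto simp: mult.assoc invertible_elements_def)
    then show ?thesis by auto
  qed
  then show "symp (pair_equiv :: 'p \<times> 'p \<Rightarrow> _)" by (auto intro!: sympI)
  have "pair_equiv (p, q) (c, d)" if pq: "pair_equiv (p, q) (a, b)" "pair_equiv (a, b) (c, d)"
    for p q a b c d :: 'p
  proof -
    obtain u v where u: "a * u = p" "b * u = q" "u * v = 1" "v * u = 1"
      using pq by (auto simp: invertible_elements_def)
    obtain u' v' where u': "c * u' = a" "d * u' = b" "u' * v' = 1" "v' * u' = 1"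
      using pq by (auto simp: invertible_elements_def)
    have "u' * u * (v * v') = 1" "v * v' * (u' * u) = 1"
      using u u' by (metis mult.assoc mult.right_neutral)+
    then have "u' * u \<in> invertible_elements" by (auto simp: invertible_elements_def)
    then show ?thesis using u u' by (auto simp: mult.assoc intro!: bexI[of _ "u' * u"])
  qed
  then show "transp (pair_equiv :: 'p \<times> 'p \<Rightarrow> _)" by (auto intro!: transpI)
qed

(* None is the zero element. *)
quotient_type (overloaded) 'p lcm_inverse_semigroup =
  "('p::right_lcm_monoid \<times> 'p) option" / "rel_option pair_equiv"
  by (rule option_equivp[OF equivp_pair_equiv])

lift_definition pair_class :: "'p::right_lcm_monoid \<Rightarrow> 'p \<Rightarrow> 'p lcm_inverse_semigroup"
  is "\<lambda>p q. Some (p, q)" .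

definition lcm_factors :: "'p::right_lcm_monoid \<Rightarrow> 'p \<Rightarrow> 'p \<times> 'p \<Rightarrow> bool" where
  "lcm_factors b c = (\<lambda>(b', c'). \<exists>r. principal_right_ideal c \<inter> principal_right_ideal b
      = principal_right_ideal r \<and> c * c' = r \<and> b * b' = r)"

(* The choice of b' and c' does not matter: see pair_class_mult. *)
fun pair_mult ::
  "('p::right_lcm_monoid \<times> 'p) option \<Rightarrow> ('p \<times> 'p) option \<Rightarrow> ('p \<times> 'p) option" where
  "pair_mult (Some (a, b)) (Some (c, d)) =
     (if principal_right_ideal c \<inter> principal_right_ideal b = {} then None
      else let (b', c') = (SOME x. lcm_factors b c x) in Some (a * b', d * c'))"
| "pair_mult _ _ = None"

lemma lcm_factors_exist:
  fixes b c :: "'p::right_lcm_monoid"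
  assumes "principal_right_ideal c \<inter> principal_right_ideal b \<noteq> {}"
  shows "\<exists>x. lcm_factors b c x"
proof -
  obtain r where r: "principal_right_ideal c \<inter> principal_right_ideal b = principal_right_ideal r"
    using principal_right_ideal_Int[OF assms] .
  have "r \<in> principal_right_ideal r" unfolding principal_right_ideal_iff by (metis mult.right_neutral)
  with r obtain x y where "r = c * x" "r = b * y" by (metis IntE principal_right_ideal_iff)
  with r show ?thesis by (auto simp: lcm_factors_def)
qed

(* The partial bijection q x |-> p x of P determined by [p, q]; used to derive the algebraic laws. *)
fun pair_graph :: "('p::right_lcm_monoid \<times> 'p) option \<Rightarrow> ('p \<times> 'p) set" where
  "pair_graph None = {}"
| "pair_graph (Some (p, q)) = {(p * x, q * x) | x. True}"

lemma pair_graph_inject: "rel_option pair_equiv s t \<longleftrightarrow> pair_graph s = pair_graph t"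
proof
  have sub: "pair_graph (Some (p, q)) \<subseteq> pair_graph (Some (a, b))" if "pair_equiv (p, q) (a, b)"
    for p q a b :: 'a
    using that by (auto simp: mult.assoc)
  assume st: "rel_option pair_equiv s t"
  show "pair_graph s = pair_graph t"
  proof (cases s)
    case (Some x)
    with st obtain y where y: "t = Some y" "pair_equiv x y" by (cases t) auto
    moreover from y(2) have "pair_equiv y x" using equivp_symp[OF equivp_pair_equiv] by blast
    ultimately show ?thesis using sub Some by (metis subset_antisym surj_pair)
  qed (use st in \<open>cases t; simp\<close>)
next
  assume eq: "pair_graph s = pair_graph t"
  have ne: "(p, q) \<in> pair_graph (Some (p, q))" for p q :: 'a
    by (auto intro!: exI[of _ 1])
  show "rel_option pair_equiv s t"
  proof (cases "s = None \<or> t = None")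
    case True
    then have "s = None \<and> t = None"
      using eq ne by (metis empty_iff not_None_eq pair_graph.simps(1) surj_pair)
    then show ?thesis by simp
  next
    case False
    then obtain x y where xy: "s = Some x" "t = Some y" by auto
    obtain p q a b where pq: "x = (p, q)" "y = (a, b)" by (cases x; cases y)
    have "(p, q) \<in> pair_graph t" "(a, b) \<in> pair_graph s"
      using eq ne xy pq by blast+
    then obtain u v where u: "p = a * u" "q = b * u" and v: "a = p * v" "b = q * v"
      unfolding xy pq by auto
    have "a * (u * v) = a * 1" "p * (v * u) = p * 1"
      using u(1) v(1) by (metis mult.assoc mult.right_neutral)+
    then have "u * v = 1" "v * u = 1" using left_cancel by blast+
    then show ?thesis using u by (auto simp: xy pq invertible_elements_def)
  qed
qed

lemma pair_graph_mult_factors: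
  assumes "lcm_factors b c (b', c')"
  shows "pair_graph (Some (a * b', d * c')) = pair_graph (Some (a, b)) O pair_graph (Some (c, d))"
proof (rule antisym; safe)
  have e: "b * b' = c * c'" using assms by (auto simp: lcm_factors_def)
  fix x y assume "(x, y) \<in> pair_graph (Some (a * b', d * c'))"
  then obtain z where z: "x = a * (b' * z)" "y = d * (c' * z)" by (auto simp: mult.assoc)
  have "b * (b' * z) = c * (c' * z)" using e by (metis mult.assoc)
  then show "(x, y) \<in> pair_graph (Some (a, b)) O pair_graph (Some (c, d))"
    unfolding z by (intro relcompI[of _ "b * (b' * z)"]) auto
next
  fix x y z assume "(x, y) \<in> pair_graph (Some (a, b))" "(y, z) \<in> pair_graph (Some (c, d))"
  then obtain k l where k: "x = a * k" "y = b * k" "y = c * l" "z = d * l" by auto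
  then have "y \<in> principal_right_ideal c \<inter> principal_right_ideal b"
    by (metis IntI principal_right_ideal_iff)
  moreover obtain r where r: "principal_right_ideal c \<inter> principal_right_ideal b = principal_right_ideal r"
    "c * c' = r" "b * b' = r" using assms by (auto simp: lcm_factors_def)
  ultimately obtain m where m: "y = r * m" unfolding r(1) principal_right_ideal_iff by blast
  have "b * k = b * (b' * m)" "c * l = c * (c' * m)"
    using k m r by (simp_all flip: mult.assoc)
  then have "k = b' * m" "l = c' * m" by (blast dest: left_cancel)+
  then show "(x, z) \<in> pair_graph (Some (a * b', d * c'))" using k by (auto simp: mult.assoc)
qed

lemma pair_graph_mult: "pair_graph (pair_mult s t) = pair_graph s O pair_graph t"
proof (cases "(s, t)" rule: pair_mult.cases)
  case (1 a b c d)
  show ?thesis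
  proof (cases "principal_right_ideal c \<inter> principal_right_ideal b = {}")
    case True
    then have "b * x \<noteq> c * y" for x y by (metis IntI empty_iff principal_right_ideal_iff)
    then have "pair_graph (Some (a, b)) O pair_graph (Some (c, d)) = {}" by auto
    then show ?thesis using 1 True by simp
  next
    case False
    obtain b' c' where x: "(SOME x. lcm_factors b c x) = (b', c')" by fastforce
    have "lcm_factors b c (b', c')"
      using someI_ex[OF lcm_factors_exist[OF False]] x by simp
    then show ?thesis using pair_graph_mult_factors[of b c b' c' a d] 1 False x by (simp del: pair_graph.simps)
  qed
qed auto

instantiation lcm_inverse_semigroup :: (right_lcm_monoid) inverse_semigroup_zero
begin

lift_definition zero_lcm_inverse_semigroup :: "'a lcm_inverse_semigroup" is None .

lift_definition times_lcm_inverse_semigroup ::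
  "'a lcm_inverse_semigroup \<Rightarrow> 'a lcm_inverse_semigroup \<Rightarrow> 'a lcm_inverse_semigroup" is pair_mult
  by (simp only: pair_graph_inject pair_graph_mult)

lift_definition star_lcm_inverse_semigroup :: "'a lcm_inverse_semigroup \<Rightarrow> 'a lcm_inverse_semigroup"
  is "map_option prod.swap"
  by (auto simp: option.rel_map elim!: option.rel_mono_strong)

lemma pair_graph_swap: "pair_graph (map_option prod.swap s) = (pair_graph s)\<inverse>"
  by (cases s) auto

lemma pair_graph_single_valued: "(x, y) \<in> pair_graph s \<Longrightarrow> (x, z) \<in> pair_graph s \<Longrightarrow> y = z"
  "(x, y) \<in> pair_graph s \<Longrightarrow> (z, y) \<in> pair_graph s \<Longrightarrow> x = z"
  by (cases s; auto dest: left_cancel)+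

instance
proof
  fix s t u :: "'a lcm_inverse_semigroup"
  show "s * t * u = s * (t * u)"
    by transfer (simp add: pair_graph_inject pair_graph_mult O_assoc)
  show "0 * s = 0" "s * 0 = 0"
    by (transfer, simp add: pair_graph_inject pair_graph_mult)+
  show "s * s\<^sup>\<star> * s = s"
    by transfer (auto simp: pair_graph_inject pair_graph_mult pair_graph_swap
        dest: pair_graph_single_valued)
  show "s\<^sup>\<star> * s * s\<^sup>\<star> = s\<^sup>\<star>"
    by transfer (auto simp: pair_graph_inject pair_graph_mult pair_graph_swap
        dest: pair_graph_single_valued)
  show "s * t * s = s \<Longrightarrow> t * s * t = t \<Longrightarrow> t = s\<^sup>\<star>"
  proof (transfer, unfold pair_graph_inject pair_graph_mult pair_graph_swap)
    fix s t :: "('a \<times> 'a) option"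
    have sub: "(pair_graph s)\<inverse> \<subseteq> pair_graph t"
      if "pair_graph s O pair_graph t O pair_graph s = pair_graph s" for s t :: "('a \<times> 'a) option"
    proof safe
      fix x y assume xy: "(x, y) \<in> pair_graph s"
      with that obtain u v where "(x, u) \<in> pair_graph s" "(u, v) \<in> pair_graph t" "(v, y) \<in> pair_graph s"
        by blast
      then show "(y, x) \<in> pair_graph t" using xy pair_graph_single_valued by metis
    qed
    assume "(pair_graph s O pair_graph t) O pair_graph s = pair_graph s"
      "(pair_graph t O pair_graph s) O pair_graph t = pair_graph t"
    then show "pair_graph t = (pair_graph s)\<inverse>"
      using sub[of s t] sub[of t s] by (auto simp: O_assoc)
  qed
qed

end

lemma pair_class_mult:
  assumes "principal_right_ideal c \<inter> principal_right_ideal b = principal_right_ideal r"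
    and "c * c' = r" "b * b' = r"
  shows "pair_class a b * pair_class c d = pair_class (a * b') (d * c')"
proof -
  have "lcm_factors b c (b', c')" using assms by (auto simp: lcm_factors_def)
  from pair_graph_mult_factors[OF this, of a d] show ?thesis
    by transfer (simp only: pair_graph_inject pair_graph_mult)
qed

lemma pair_class_mult_disjoint:
  "principal_right_ideal c \<inter> principal_right_ideal b = {} \<Longrightarrow> pair_class a b * pair_class c d = 0"
  by transfer simp

lemma star_pair_class: "(pair_class p q)\<^sup>\<star> = pair_class q p"
  by transfer (simp only: pair_graph_inject pair_graph_swap, auto)

end

theory Submission
  imports Defs
begin

text \<open>
  Both algebras are universal, so the two mutually inverse star-homomorphisms come from checking
  that each side satisfies the defining relations of the other; each composite fixes the generators
  and is therefore the identity.

  Under the isomorphism \<open>v_p\<close> corresponds to \<open>[p, 1]\<close> and \<open>e_X\<close> to the idempotent with domain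
  \<open>X\<close>. Computations in the inverse semigroup become transparent once \<open>[p, q]\<close> is read as the
  partial bijection \<open>q x \<mapsto> p x\<close> of \<open>P\<close>: idempotents are then the identities on the subsets
  \<open>pP\<close> and \<open>\<emptyset>\<close>, their product is intersection of these subsets, and conjugating by \<open>[p, 1]\<close> or
  \<open>[1, p]\<close> realises the translates \<open>pX\<close> and the preimages \<open>p\<^sup>-\<^sup>1X\<close>. In particular each
  constructible ideal is the domain of an idempotent (\<open>ex_ideal_idempotent\<close>), which gives the
  relations of the semigroup algebra on the tight side. A finite set \<open>F\<close> is a foundation set
  precisely if the idempotents \<open>[f, f]\<close> with \<open>f \<in> F\<close> cover all idempotents; tightness makes
  their join \<open>1\<close>, and the product of the complements is \<open>1\<close> minus the join
  (\<open>prod_complements_eq_join\<close>).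

  Conversely \<open>[p, q] \<mapsto> v_p v_q\<^sup>*\<close> is a representation in the boundary quotient, because
  \<open>v_b\<^sup>* v_c\<close> is governed by \<open>e_{bP \<inter> cP}\<close>. The point is that it is tight although only covers of
  the whole of \<open>P\<close> are among the relations. Given finite \<open>X\<close>, \<open>Y\<close> and a cover \<open>Z\<close> of the
  idempotents below \<open>X\<close> and orthogonal to \<open>Y\<close>, the meet of \<open>X\<close> is \<open>0\<close>, a trivial case, or some
  \<open>[r, r]\<close>. Every nonzero idempotent below \<open>[r, r]\<close> meets a member of \<open>Y\<close> or is a member of the
  covered set and so meets a member of \<open>Z\<close>. Cutting the members of \<open>Y \<union> Z\<close> down to \<open>rP\<close> and
  cancelling \<open>r\<close> yields a foundation set, whose relation, transported back by \<open>v_r\<close>, is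
  \<open>e_{rP} \<Prod>_{w \<in> Y \<union> Z} (1 - \<pi>(w)) = 0\<close> (\<open>localized_foundation\<close>). Since \<open>Z\<close> lies below
  \<open>e_{rP} \<Prod>_{y \<in> Y} (1 - \<pi>(y))\<close>, this forces the join of \<open>Z\<close> to equal that projection
  (\<open>tight_boundary_representation\<close>).
\<close>

section \<open>Joins and products of complements\<close>

text \<open>Induction on \<open>1 - (x + j - x j) = (1 - x) (1 - j)\<close>, which holds in any unital ring; the order of the
  factors on both sides is that of the list.\<close>

lemma prod_complements_eq_join:
  "prod_list (map (\<lambda>x. 1 - f x) xs) = 1 - join_list (map f xs :: 'a::star_algebra list)"
proof (induction xs)
  case (Cons x xs)
  then show ?case by (simp del: diff_eq_eq) (simp add: algebra_simps)
qed simp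

lemma complement_mult_prod_complements:
  fixes f :: "'b \<Rightarrow> 'a::star_algebra"
  assumes "\<And>x y. x \<in> set xs \<Longrightarrow> y \<in> set xs \<Longrightarrow> f x * f y = f y * f x"
    and "\<And>x. x \<in> set xs \<Longrightarrow> f x * f x = f x" and "a \<in> set xs"
  shows "(1 - f a) * prod_list (map (\<lambda>x. 1 - f x) xs) = prod_list (map (\<lambda>x. 1 - f x) xs)"
  using assms
proof (induction xs)
  case (Cons b xs)
  let ?P = "prod_list (map (\<lambda>x. 1 - f x) xs)"
  show ?case
  proof (cases "a = b")
    case True
    have "(1 - f b) * (1 - f b) = 1 - f b" using Cons.prems(2)[of b] by (simp add: algebra_simps)
    then show ?thesis by (simp add: True flip: mult.assoc)
  next
    case False
    then have "(1 - f a) * ?P = ?P" using Cons by simp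
    moreover have "(1 - f a) * (1 - f b) = (1 - f b) * (1 - f a)"
      using Cons.prems(1)[of a b] Cons.prems(3) by (simp add: algebra_simps)
    then have "(1 - f a) * ((1 - f b) * ?P) = (1 - f b) * ((1 - f a) * ?P)"
      by (simp only: mult.assoc[symmetric])
    ultimately show ?thesis by simp
  qed
qed simp

text \<open>Foundation relations are indexed by elements of \<open>P\<close> and covers by idempotents, and distinct
  elements may give the same idempotent. Passing from one enumeration to the other needs the freedom
  to drop repetitions.\<close>

lemma prod_complements_remdups:
  fixes f :: "'b \<Rightarrow> 'a::star_algebra"
  assumes "\<And>x y. x \<in> set xs \<Longrightarrow> y \<in> set xs \<Longrightarrow> f x * f y = f y * f x"
    and "\<And>x. x \<in> set xs \<Longrightarrow> f x * f x = f x"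
  shows "prod_list (map (\<lambda>x. 1 - f x) (remdups xs)) = prod_list (map (\<lambda>x. 1 - f x) xs)"
  using assms
proof (induction xs)
  case (Cons a xs)
  then have "prod_list (map (\<lambda>x. 1 - f x) (remdups xs)) = prod_list (map (\<lambda>x. 1 - f x) xs)" by simp
  then show ?case using complement_mult_prod_complements[of xs f a] Cons.prems by simp
qed simp

lemma mult_join_list_absorb:
  fixes a :: "'a::star_algebra"
  assumes "\<And>x. x \<in> set xs \<Longrightarrow> a * x = x"
  shows "a * join_list xs = join_list xs"
  using assms by (induction xs) (simp_all add: algebra_simps flip: mult.assoc)

lemma prod_complements_mult_orthogonal:
  fixes z :: "'a::star_algebra"
  assumes "\<And>x. x \<in> set xs \<Longrightarrow> f x * z = 0"
  shows "prod_list (map (\<lambda>x. 1 - f x) xs) * z = z"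
  using assms by (induction xs) (simp_all add: mult.assoc left_diff_distrib)


section \<open>Elements of the inverse semigroup as partial bijections\<close>

text \<open>The map below is a faithful representation of the inverse semigroup by relations on \<open>P\<close>, so an
  identity in the semigroup can be checked as an identity of relations.\<close>

lift_definition partial_bijection :: "'p::right_lcm_monoid lcm_inverse_semigroup \<Rightarrow> ('p \<times> 'p) set"
  is pair_graph by (simp add: pair_graph_inject)

lemma partial_bijection_eq_iff: "s = t \<longleftrightarrow> partial_bijection s = partial_bijection t"
  by transfer (rule pair_graph_inject)

lemma partial_bijection_mult:
  "partial_bijection (s * t) = partial_bijection s O partial_bijection t"
  by transfer (rule pair_graph_mult)

lemma partial_bijection_zero [simp]: "partial_bijection 0 = {}"
  by transfer simp

lemma partial_bijection_pair_class:
  "partial_bijection (pair_class p q) = {(p * x, q * x) | x. True}"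
  by transfer simp

lemma partial_bijection_pair_class_self:
  "partial_bijection (pair_class p p) = Id_on (principal_right_ideal p)"
  by (auto simp: partial_bijection_pair_class principal_right_ideal_iff)

lemma partial_bijection_pair_class_one: "partial_bijection (pair_class 1 1) = Id"
  by (auto simp: partial_bijection_pair_class)

lemma pair_class_cases:
  obtains "s = 0" | p q where "s = pair_class p q"
  by (transfer fixing: thesis) (metis equivp_pair_equiv option.exhaust option_equivp equivp_reflp surj_pair)

lemma pair_class_nonzero: "pair_class p q \<noteq> 0"
  by transfer simp

lemma pair_class_one_mult [simp]: "pair_class 1 1 * s = s" "s * pair_class 1 1 = s"
  by (simp_all add: partial_bijection_eq_iff partial_bijection_mult partial_bijection_pair_class_one)

lemma pair_class_factor: "pair_class p 1 * pair_class 1 q = pair_class p q"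
  by (simp add: partial_bijection_eq_iff partial_bijection_mult partial_bijection_pair_class, fast)

lemma pair_class_isometry: "pair_class 1 p * pair_class p 1 = pair_class 1 1"
  by (simp add: partial_bijection_eq_iff partial_bijection_mult partial_bijection_pair_class,
      fast dest: left_cancel)

lemma pair_class_isometry_mult: "pair_class p 1 * pair_class q 1 = pair_class (p * q) 1"
  by (simp add: partial_bijection_eq_iff partial_bijection_mult partial_bijection_pair_class
      mult.assoc, fast)

lemma partial_bijection_mult_Id_on:
  assumes "partial_bijection s = Id_on X" "partial_bijection t = Id_on Y"
  shows "partial_bijection (s * t) = Id_on (X \<inter> Y)"
  unfolding partial_bijection_mult assms by auto

lemma partial_bijection_translate:
  assumes "partial_bijection s = Id_on X"
  shows "partial_bijection (pair_class p 1 * s * pair_class 1 p) = Id_on {p * x | x. x \<in> X}"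
  by (simp add: partial_bijection_mult partial_bijection_pair_class assms O_assoc, fast)

lemma partial_bijection_preimage:
  assumes "partial_bijection s = Id_on X"
  shows "partial_bijection (pair_class 1 p * s * pair_class p 1) = Id_on {y. p * y \<in> X}"
  by (simp add: partial_bijection_mult partial_bijection_pair_class assms O_assoc,
      fast dest: left_cancel)

lemma pair_class_mult_self_nonzero_iff:
  "pair_class p p * pair_class q q \<noteq> 0 \<longleftrightarrow> principal_right_ideal p \<inter> principal_right_ideal q \<noteq> {}"
  by (auto simp: partial_bijection_eq_iff partial_bijection_mult partial_bijection_pair_class_self)

text \<open>An idempotent partial bijection \<open>f\<close> satisfies \<open>f (f x) = f x\<close>, and injectivity gives
  \<open>f x = x\<close>.\<close>

lemma partial_bijection_idempotent:
  assumes "e \<in> idempotents"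
  shows "partial_bijection e \<subseteq> Id"
proof -
  have "partial_bijection e O partial_bijection e = partial_bijection e"
    using assms by (simp add: idempotents_def flip: partial_bijection_mult)
  moreover have "(x, y) \<in> partial_bijection e \<Longrightarrow> (x, z) \<in> partial_bijection e \<Longrightarrow> y = z"
    "(x, y) \<in> partial_bijection e \<Longrightarrow> (z, y) \<in> partial_bijection e \<Longrightarrow> x = z" for x y z
    by (transfer, rule pair_graph_single_valued, assumption+)+
  ultimately show ?thesis by (smt (verit) IdI relcompE subrelI)
qed

lemma idempotent_cases:
  assumes "e \<in> idempotents"
  obtains "e = 0" | p where "e = pair_class p p"
proof (cases e rule: pair_class_cases)
  case (2 p q)
  have "(p * 1, q * 1) \<in> partial_bijection e" unfolding 2 partial_bijection_pair_class by blast
  with partial_bijection_idempotent[OF assms] have "p = q" by auto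
  with 2 that show ?thesis by blast
qed (use that in blast)

lemma idempotents_commute:
  fixes s t :: "'p::right_lcm_monoid lcm_inverse_semigroup"
  assumes "s \<in> idempotents" "t \<in> idempotents"
  shows "s * t = t * s"
  using partial_bijection_idempotent[OF assms(1)] partial_bijection_idempotent[OF assms(2)]
  by (auto simp: partial_bijection_eq_iff partial_bijection_mult)

lemma idempotents_mult:
  fixes s t :: "'p::right_lcm_monoid lcm_inverse_semigroup"
  assumes "s \<in> idempotents" "t \<in> idempotents"
  shows "s * t \<in> idempotents"
proof -
  have "s * t * (s * t) = s * (t * s) * t" by (simp add: mult.assoc)
  also have "\<dots> = s * s * (t * t)" by (simp only: idempotents_commute[OF assms(2,1)] mult.assoc)
  finally show ?thesis using assms by (simp add: idempotents_def)
qed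

lemma pair_class_self_idempotent: "pair_class p p \<in> idempotents"
  by (auto simp: idempotents_def partial_bijection_eq_iff partial_bijection_mult
      partial_bijection_pair_class_self)


section \<open>The idempotent of a constructible ideal\<close>

text \<open>Each closure property of the constructible ideals is matched by an operation of the inverse
  semigroup: intersection by the product, translate and preimage by conjugation with
  \<open>[p, 1]\<close> and \<open>[1, p]\<close>.\<close>

lemma ex_ideal_idempotent:
  assumes "X \<in> constructible_ideals"
  shows "\<exists>s. partial_bijection s = Id_on (X :: 'p::right_lcm_monoid set)"
  using assms
proof (induction rule: constructible_ideals.induct)
  case full
  show ?case by (rule exI[of _ "pair_class 1 1"]) (auto simp: partial_bijection_pair_class_one)
next
  case empty
  show ?case by (rule exI[of _ 0]) auto
next
  case (Int X Y)
  then obtain s t where "partial_bijection s = Id_on X" "partial_bijection t = Id_on Y" by auto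
  from partial_bijection_mult_Id_on[OF this] show ?case ..
next
  case (translate X p)
  then obtain s where "partial_bijection s = Id_on X" by auto
  from partial_bijection_translate[OF this] show ?case ..
next
  case (preimage X p)
  then obtain s where "partial_bijection s = Id_on X" by auto
  from partial_bijection_preimage[OF this] show ?case ..
qed

definition ideal_idempotent ::
  "'p::right_lcm_monoid constructible_ideal \<Rightarrow> 'p lcm_inverse_semigroup" where
  "ideal_idempotent X = (SOME s. partial_bijection s = Id_on (Rep_constructible_ideal X))"

lemma partial_bijection_ideal_idempotent:
  "partial_bijection (ideal_idempotent X) = Id_on (Rep_constructible_ideal X)"
  unfolding ideal_idempotent_def
  by (rule someI_ex[OF ex_ideal_idempotent[OF Rep_constructible_ideal]])

lemma ideal_idempotent_eqI:
  "partial_bijection s = Id_on (Rep_constructible_ideal X) \<Longrightarrow> ideal_idempotent X = s"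
  by (simp add: partial_bijection_eq_iff partial_bijection_ideal_idempotent)

lemma ideal_idempotent_idempotent: "ideal_idempotent X \<in> idempotents"
  by (simp add: idempotents_def partial_bijection_eq_iff
      partial_bijection_mult_Id_on[OF partial_bijection_ideal_idempotent
        partial_bijection_ideal_idempotent] partial_bijection_ideal_idempotent)

lemma ideal_idempotent_Int:
  "ideal_idempotent (ideal_Int X Y) = ideal_idempotent X * ideal_idempotent Y"
  by (rule ideal_idempotent_eqI, unfold ideal_Int.rep_eq)
    (intro partial_bijection_mult_Id_on partial_bijection_ideal_idempotent)

lemma ideal_idempotent_translate:
  "ideal_idempotent (ideal_translate p X) = pair_class p 1 * ideal_idempotent X * pair_class 1 p"
  by (rule ideal_idempotent_eqI, unfold ideal_translate.rep_eq)
    (intro partial_bijection_translate partial_bijection_ideal_idempotent)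

lemma ideal_idempotent_full: "ideal_idempotent full_ideal = pair_class 1 1"
  by (rule ideal_idempotent_eqI) (auto simp: full_ideal.rep_eq partial_bijection_pair_class_one)

lemma ideal_idempotent_empty: "ideal_idempotent empty_ideal = 0"
  by (rule ideal_idempotent_eqI) (auto simp: empty_ideal.rep_eq)

lemma ideal_idempotent_principal: "ideal_idempotent (principal_constructible p) = pair_class p p"
  by (rule ideal_idempotent_eqI)
    (simp add: principal_constructible.rep_eq partial_bijection_pair_class_self)

text \<open>Since the idempotents of the inverse semigroup are known, the correspondence also shows that
  constructible ideals are principal or empty.\<close>

lemma constructible_ideal_cases:
  fixes X :: "'p::right_lcm_monoid constructible_ideal"
  obtains "X = empty_ideal" | p where "X = principal_constructible p"
proof -
  have inj: "X = Y" if "ideal_idempotent X = ideal_idempotent Y" for Y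
  proof -
    have "Id_on (Rep_constructible_ideal X) = Id_on (Rep_constructible_ideal Y)"
      using that by (metis partial_bijection_ideal_idempotent)
    then show ?thesis by (metis Domain_Id_on Rep_constructible_ideal_inject)
  qed
  show thesis
    by (rule idempotent_cases[OF ideal_idempotent_idempotent[of X]])
      (metis inj that ideal_idempotent_empty ideal_idempotent_principal)+
qed


section \<open>From the boundary quotient to the tight algebra\<close>

lemma tight_eq: "(l, r) \<in> tight_equations universal_tight \<Longrightarrow> l = r"
  using tight_representation_universal_tight by (auto simp: tight_representation_def)

lemmas universal_tight_mult = tight_eq[OF tight_equations.mult]
  and universal_tight_star = tight_eq[OF tight_equations.star]
  and universal_tight_zero = tight_eq[OF tight_equations.zero]

text \<open>Tightness with \<open>X = Y = \<emptyset>\<close> forces a representation to be unital, as the identity alone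
  covers all idempotents.\<close>

lemma universal_tight_one: "universal_tight (pair_class 1 1) = 1"
proof -
  have "is_cover (set [pair_class 1 1]) (idempotents_between (set []) (set []))"
    by (auto simp: is_cover_def idempotents_between_def pair_class_self_idempotent)
  from tight_eq[OF tight_equations.tight[OF _ _ _ _ _ this]] show ?thesis by simp
qed

lemma foundation_set_cover:
  assumes "foundation_set F"
  shows "is_cover ((\<lambda>p. pair_class p p) ` F) (idempotents_between {} {})"
  unfolding is_cover_def
proof (intro conjI ballI impI)
  show "(\<lambda>p. pair_class p p) ` F \<subseteq> idempotents_between {} {}"
    by (auto simp: idempotents_between_def pair_class_self_idempotent)
next
  fix z :: "'a lcm_inverse_semigroup"
  assume z: "z \<in> idempotents_between {} {}" "z \<noteq> 0"
  then have "z \<in> idempotents" by (simp add: idempotents_between_def)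
  then obtain q where "z = pair_class q q" using z by (cases rule: idempotent_cases) auto
  then show "\<exists>f\<in>(\<lambda>p. pair_class p p) ` F. f * z \<noteq> 0"
    using assms by (auto simp: foundation_set_def pair_class_mult_self_nonzero_iff)
qed

lemma universal_tight_foundation:
  assumes "foundation_set (set ps)"
  shows "prod_list (map (\<lambda>p. 1 - universal_tight (pair_class p p)) ps) = 0"
proof -
  define zs where "zs = map (\<lambda>p. pair_class p p) ps"
  have idem: "set zs \<subseteq> idempotents" by (auto simp: zs_def pair_class_self_idempotent)
  have "is_cover (set (remdups zs)) (idempotents_between (set []) (set []))"
    using foundation_set_cover[OF assms] by (simp add: zs_def)
  from tight_eq[OF tight_equations.tight[OF _ _ _ _ _ this]]
  have "join_list (map universal_tight (remdups zs)) = 1" by simp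
  then have "prod_list (map (\<lambda>s. 1 - universal_tight s) (remdups zs)) = 0"
    by (simp add: prod_complements_eq_join)
  moreover have "prod_list (map (\<lambda>s. 1 - universal_tight s) (remdups zs))
      = prod_list (map (\<lambda>s. 1 - universal_tight s) zs)"
  proof (rule prod_complements_remdups)
    fix s t assume "s \<in> set zs" "t \<in> set zs"
    then have "s * t = t * s" using idem idempotents_commute by blast
    then show "universal_tight s * universal_tight t = universal_tight t * universal_tight s"
      by (simp flip: universal_tight_mult)
  next
    fix s assume "s \<in> set zs"
    then have "s * s = s" using idem by (auto simp: idempotents_def)
    then show "universal_tight s * universal_tight s = universal_tight s"
      by (simp flip: universal_tight_mult)
  qed
  ultimately show ?thesis by (simp add: zs_def o_def)
qed

lemma boundary_equations_universal_tight:
  assumes "(l, r) \<in> boundary_equations (\<lambda>p. universal_tight (pair_class p 1))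
    (\<lambda>X. universal_tight (ideal_idempotent X))"
  shows "l = r"
  using assms
proof cases
  case semigroup
  from semigroup show ?thesis
  proof cases
    case (isometry p)
    then show ?thesis
      by (simp add: universal_tight_one star_pair_class pair_class_isometry
          flip: universal_tight_mult universal_tight_star)
  next
    case (selfadjoint X)
    have "(ideal_idempotent X)\<^sup>\<star> = ideal_idempotent X"
      using ideal_idempotent_idempotent[of X]
      by (intro inverse_unique[symmetric]) (simp_all add: idempotents_def)
    then show ?thesis using selfadjoint by (simp flip: universal_tight_star)
  next
    case (idempotent X)
    then show ?thesis using ideal_idempotent_idempotent[of X]
      by (simp add: idempotents_def flip: universal_tight_mult)
  next
    case (L1 p q)
    then show ?thesis by (simp add: pair_class_isometry_mult flip: universal_tight_mult)
  next
    case (L2 p X)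
    then show ?thesis
      by (simp add: ideal_idempotent_translate star_pair_class
          flip: universal_tight_mult universal_tight_star)
  next
    case L3_full
    then show ?thesis by (simp add: ideal_idempotent_full universal_tight_one)
  next
    case L3_empty
    then show ?thesis by (simp add: ideal_idempotent_empty universal_tight_zero)
  next
    case (L4 X Y)
    then show ?thesis by (simp add: ideal_idempotent_Int universal_tight_mult)
  qed
next
  case (foundation ps)
  then show ?thesis by (simp add: ideal_idempotent_principal universal_tight_foundation)
qed


section \<open>From the tight algebra to the boundary quotient\<close>

lemmas boundary_semigroup_eq = boundary_quotient_relations[OF boundary_equations.semigroup]

lemmas boundary_v_isometry = boundary_semigroup_eq[OF semigroup_equations.isometry]
  and boundary_e_idempotent = boundary_semigroup_eq[OF semigroup_equations.idempotent]
  and boundary_v_mult = boundary_semigroup_eq[OF semigroup_equations.L1]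
  and boundary_e_translate = boundary_semigroup_eq[OF semigroup_equations.L2]
  and boundary_e_full = boundary_semigroup_eq[OF semigroup_equations.L3_full]
  and boundary_e_empty = boundary_semigroup_eq[OF semigroup_equations.L3_empty]
  and boundary_e_Int = boundary_semigroup_eq[OF semigroup_equations.L4]

lemma boundary_v_one: "boundary_v 1 = 1"
proof -
  let ?V = "boundary_v 1"
  have "?V = (?V\<^sup>\<star> * ?V) * ?V" by (simp add: boundary_v_isometry)
  also have "\<dots> = ?V\<^sup>\<star> * ?V" by (simp only: mult.assoc boundary_v_mult mult.left_neutral)
  finally show ?thesis by (simp add: boundary_v_isometry)
qed

lemma boundary_v_range_projection:
  "boundary_v p * (boundary_v p)\<^sup>\<star> = boundary_e (principal_constructible p)"
proof -
  have "ideal_translate p full_ideal = principal_constructible p"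
    by transfer (auto simp: principal_right_ideal_def)
  then show ?thesis using boundary_e_translate[of p full_ideal] by (simp add: boundary_e_full)
qed

lemma boundary_e_commute: "boundary_e X * boundary_e Y = boundary_e Y * boundary_e X"
proof -
  have "ideal_Int X Y = ideal_Int Y X" by transfer auto
  then show ?thesis by (simp add: boundary_e_Int)
qed

text \<open>Insert the range projections \<open>v_b v_b\<^sup>*\<close> and \<open>v_c v_c\<^sup>*\<close> in the middle: the product
  \<open>v_b\<^sup>* v_c\<close> only depends on the part over \<open>bP \<inter> cP\<close>.\<close>

lemma boundary_v_star_mult:
  fixes b c :: "'p::right_lcm_monoid"
  shows "(boundary_v b)\<^sup>\<star> * boundary_v c = (boundary_v b)\<^sup>\<star>
    * boundary_e (ideal_Int (principal_constructible b) (principal_constructible c)) * boundary_v c"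
    (is "_ = ?R")
proof -
  have "?R = ((boundary_v b)\<^sup>\<star> * boundary_v b) * ((boundary_v b)\<^sup>\<star> * boundary_v c)
      * ((boundary_v c)\<^sup>\<star> * boundary_v c)"
    by (simp add: mult.assoc flip: boundary_e_Int boundary_v_range_projection)
  then show ?thesis by (simp add: boundary_v_isometry)
qed

text \<open>Well defined on classes because an invertible \<open>u\<close> gives a unitary \<open>v_u\<close>.\<close>

lift_definition boundary_representation ::
  "'p::right_lcm_monoid lcm_inverse_semigroup \<Rightarrow> 'p boundary_quotient"
  is "\<lambda>s. case s of None \<Rightarrow> 0 | Some (p, q) \<Rightarrow> boundary_v p * (boundary_v q)\<^sup>\<star>"
proof -
  fix s t :: "('p \<times> 'p) option"
  assume st: "rel_option pair_equiv s t"
  show "(case s of None \<Rightarrow> 0 | Some (p, q) \<Rightarrow> boundary_v p * (boundary_v q)\<^sup>\<star>)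
    = (case t of None \<Rightarrow> 0 | Some (p, q) \<Rightarrow> boundary_v p * (boundary_v q)\<^sup>\<star>)"
  proof (cases s)
    case (Some x)
    with st obtain p q a b where pq: "s = Some (p, q)" "t = Some (a, b)" "pair_equiv (p, q) (a, b)"
      by (cases t; cases x) auto
    then obtain u w where u: "p = a * u" "q = b * u" "u * w = 1"
      by (auto simp: invertible_elements_def)
    have uw: "boundary_v u * boundary_v w = 1"
      using u(3) boundary_v_mult[of u w] by (simp add: boundary_v_one)
    have "(boundary_v u)\<^sup>\<star> = (boundary_v u)\<^sup>\<star> * (boundary_v u * boundary_v w)"
      by (simp add: uw)
    also have "\<dots> = boundary_v w" by (simp add: boundary_v_isometry flip: mult.assoc)
    finally have "boundary_v u * (boundary_v u)\<^sup>\<star> = 1" using uw by simp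
    then have "boundary_v p * (boundary_v q)\<^sup>\<star> = boundary_v a * (boundary_v b)\<^sup>\<star>"
      unfolding u(1,2) boundary_v_mult[symmetric] star_mult
      by (simp add: mult.assoc) (simp flip: mult.assoc)
    then show ?thesis using pq by simp
  qed (use st in simp)
qed

lemma boundary_representation_pair_class:
  "boundary_representation (pair_class p q) = boundary_v p * (boundary_v q)\<^sup>\<star>"
  by transfer simp

lemma boundary_representation_zero: "boundary_representation 0 = 0"
  by transfer simp

lemma boundary_representation_one: "boundary_representation (pair_class 1 1) = 1"
  by (simp add: boundary_representation_pair_class boundary_v_one)

lemma boundary_representation_mult:
  fixes s t :: "'p::right_lcm_monoid lcm_inverse_semigroup"
  shows "boundary_representation (s * t) = boundary_representation s * boundary_representation t"
proof (cases s rule: pair_class_cases)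
  case (2 a b)
  show ?thesis
  proof (cases t rule: pair_class_cases)
    case t: (2 c d)
    let ?I = "ideal_Int (principal_constructible b) (principal_constructible c)"
    have "boundary_representation s * boundary_representation t
        = boundary_v a * ((boundary_v b)\<^sup>\<star> * boundary_v c) * (boundary_v d)\<^sup>\<star>"
      by (simp add: 2 t boundary_representation_pair_class mult.assoc)
    also have "\<dots> = boundary_representation (s * t)"
    proof (cases "principal_right_ideal c \<inter> principal_right_ideal b = {}")
      case True
      have "?I = empty_ideal" using True by transfer auto
      then have "(boundary_v b)\<^sup>\<star> * boundary_v c = 0"
        using boundary_v_star_mult[of b c] by (simp add: boundary_e_empty)
      then show ?thesis
        by (simp add: 2 t pair_class_mult_disjoint[OF True] boundary_representation_zero)
    next
      case False
      then obtain b' c' r where r: "principal_right_ideal c \<inter> principal_right_ideal b = principal_right_ideal r"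
        "c * c' = r" "b * b' = r"
        using lcm_factors_exist[of c b] by (auto simp: lcm_factors_def)
      have "?I = principal_constructible r" using r(1) by transfer auto
      then have "(boundary_v b)\<^sup>\<star> * boundary_v c
          = (boundary_v b)\<^sup>\<star> * (boundary_v r * (boundary_v r)\<^sup>\<star>) * boundary_v c"
        using boundary_v_star_mult[of b c] by (simp add: boundary_v_range_projection)
      also have "\<dots> = (boundary_v b)\<^sup>\<star> * ((boundary_v b * boundary_v b')
          * ((boundary_v c')\<^sup>\<star> * (boundary_v c)\<^sup>\<star>)) * boundary_v c"
        by (simp only: boundary_v_mult star_mult[symmetric] r(2,3))
      also have "\<dots> = ((boundary_v b)\<^sup>\<star> * boundary_v b) * (boundary_v b' * (boundary_v c')\<^sup>\<star>)
          * ((boundary_v c)\<^sup>\<star> * boundary_v c)"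
        by (simp add: mult.assoc)
      also have "\<dots> = boundary_v b' * (boundary_v c')\<^sup>\<star>" by (simp add: boundary_v_isometry)
      finally show ?thesis
        by (simp add: 2 t pair_class_mult[OF r] boundary_representation_pair_class star_mult
            mult.assoc flip: boundary_v_mult)
    qed
    finally show ?thesis ..
  qed (simp add: boundary_representation_zero)
qed (simp add: boundary_representation_zero)

lemma boundary_representation_star:
  "boundary_representation (s\<^sup>\<star>) = (boundary_representation s)\<^sup>\<star>"
proof (cases s rule: pair_class_cases)
  case 1
  have "(0::'a lcm_inverse_semigroup)\<^sup>\<star> = 0" by transfer simp
  then show ?thesis by (simp add: 1 boundary_representation_zero)
qed (simp add: star_pair_class boundary_representation_pair_class star_mult star_star)

lemma boundary_representation_ideal_idempotent:
  "boundary_representation (ideal_idempotent X) = boundary_e X"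
  by (cases X rule: constructible_ideal_cases)
    (simp_all add: ideal_idempotent_empty ideal_idempotent_principal boundary_representation_zero
      boundary_representation_pair_class boundary_e_empty boundary_v_range_projection)

lemma boundary_foundation:
  assumes "foundation_set (set ps)"
  shows "prod_list (map (\<lambda>p. 1 - boundary_e (principal_constructible p)) ps) = 0"
proof -
  have "prod_list (map (\<lambda>p. 1 - boundary_e (principal_constructible p)) (remdups ps)) = 0"
    by (rule boundary_quotient_relations[OF boundary_equations.foundation]) (use assms in simp_all)
  then show ?thesis
    by (subst (asm) prod_complements_remdups) (simp_all add: boundary_e_idempotent boundary_e_commute)
qed

lemma pair_class_self_mult_absorb:
  "pair_class (r * p) (r * p) * pair_class r r = pair_class (r * p) (r * p)"
proof -
  have "principal_right_ideal (r * p) \<inter> principal_right_ideal r = principal_right_ideal (r * p)"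
    by (auto simp: principal_right_ideal_iff mult.assoc)
  then show ?thesis
    by (simp add: partial_bijection_eq_iff partial_bijection_pair_class_self
        partial_bijection_mult_Id_on[OF partial_bijection_pair_class_self
          partial_bijection_pair_class_self])
qed

text \<open>The foundation relation holds inside every \<open>rP\<close>. If \<open>ws\<close> meets every nonzero idempotent below
  \<open>[r, r]\<close>, write \<open>[r, r] w = [r s, r s]\<close> for those \<open>w\<close> that meet \<open>[r, r]\<close>. By left
  cancellation the elements \<open>s\<close> form a foundation set. Moreover
  \<open>v_r\<^sup>* (1 - \<pi>(w)) = (1 - e_{sP}) v_r\<^sup>*\<close>, while \<open>v_r\<^sup>*\<close> absorbs \<open>1 - \<pi>(w)\<close> for the other
  \<open>w\<close>, so moving \<open>v_r\<^sup>*\<close> through the product turns it into the one that vanishes for that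
  foundation set.\<close>

lemma localized_foundation:
  fixes r :: "'p::right_lcm_monoid"
  assumes idem: "set ws \<subseteq> idempotents"
    and meets: "\<And>p. \<exists>w\<in>set ws. pair_class (r * p) (r * p) * w \<noteq> 0"
  shows "boundary_representation (pair_class r r)
    * prod_list (map (\<lambda>w. 1 - boundary_representation w) ws) = 0"
proof -
  let ?r = "pair_class r r"
  let ?V = "boundary_v r :: 'p boundary_quotient"
  define g where "g w = (SOME s. ?r * w = pair_class (r * s) (r * s))" for w
  have g: "?r * w = pair_class (r * g w) (r * g w)" if w: "w \<in> idempotents" "?r * w \<noteq> 0" for w
  proof -
    have "?r * w \<in> idempotents" by (intro idempotents_mult pair_class_self_idempotent w)
    then obtain q where q: "?r * w = pair_class q q" using w(2) by (cases rule: idempotent_cases) auto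
    have "(q, q) \<in> partial_bijection (pair_class q q)"
      unfolding partial_bijection_pair_class_self principal_right_ideal_iff Id_on_iff
      by (metis mult.right_neutral)
    then have "(q, q) \<in> partial_bijection ?r O partial_bijection w"
      by (simp only: q[symmetric] partial_bijection_mult)
    then obtain s where "q = r * s" by (auto simp: partial_bijection_pair_class)
    with q have "?r * w = pair_class (r * s) (r * s)" by simp
    then show ?thesis unfolding g_def by (rule someI)
  qed
  let ?us = "filter (\<lambda>w. ?r * w \<noteq> 0) ws"
  have star: "?V\<^sup>\<star> * (1 - boundary_representation w)
      = (1 - (if ?r * w = 0 then 0 else boundary_e (principal_constructible (g w)))) * ?V\<^sup>\<star>"
    if "w \<in> idempotents" for w
  proof -
    have "?V\<^sup>\<star> * boundary_representation w = (?V\<^sup>\<star> * ?V) * (?V\<^sup>\<star> * boundary_representation w)"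
      by (simp add: boundary_v_isometry)
    also have "\<dots> = ?V\<^sup>\<star> * boundary_representation (?r * w)"
      by (simp add: boundary_representation_mult boundary_representation_pair_class mult.assoc)
    also have "\<dots> = (if ?r * w = 0 then 0 else boundary_e (principal_constructible (g w))) * ?V\<^sup>\<star>"
    proof (cases "?r * w = 0")
      case False
      have "?V\<^sup>\<star> * boundary_representation (?r * w)
        = (?V\<^sup>\<star> * ?V) * (boundary_v (g w) * (boundary_v (g w))\<^sup>\<star>) * ?V\<^sup>\<star>"
        by (simp add: g[OF that False] boundary_representation_pair_class star_mult mult.assoc
            flip: boundary_v_mult)
      then show ?thesis using False by (simp add: boundary_v_isometry boundary_v_range_projection)
    qed (simp add: boundary_representation_zero)
    finally show ?thesis by (simp add: algebra_simps)
  qed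
  have inter: "?V\<^sup>\<star> * prod_list (map (\<lambda>w. 1 - boundary_representation w) ws)
      = prod_list (map (\<lambda>w. 1 - boundary_e (principal_constructible (g w))) ?us) * ?V\<^sup>\<star>"
    using idem
  proof (induction ws)
    case (Cons w ws)
    let ?W = "prod_list (map (\<lambda>w. 1 - boundary_representation w) ws)"
    have "?V\<^sup>\<star> * ((1 - boundary_representation w) * ?W)
      = (1 - (if ?r * w = 0 then 0 else boundary_e (principal_constructible (g w)))) * (?V\<^sup>\<star> * ?W)"
      using star[of w] Cons.prems by (simp flip: mult.assoc)
    moreover have "?V\<^sup>\<star> * ?W = prod_list (map (\<lambda>w. 1 - boundary_e (principal_constructible (g w)))
        (filter (\<lambda>w. ?r * w \<noteq> 0) ws)) * ?V\<^sup>\<star>"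
      using Cons by simp
    ultimately show ?case by (simp add: mult.assoc)
  qed simp
  have "foundation_set (set (map g ?us))"
    unfolding foundation_set_def
  proof (intro conjI allI)
    fix p
    obtain w where w: "w \<in> set ws" "pair_class (r * p) (r * p) * w \<noteq> 0" using meets by blast
    have ne: "pair_class (r * p) (r * p) * (?r * w) \<noteq> 0"
      using w(2) by (simp add: pair_class_self_mult_absorb flip: mult.assoc)
    then have rw: "?r * w \<noteq> 0" by auto
    then have gw: "?r * w = pair_class (r * g w) (r * g w)" using g idem w(1) by auto
    have "principal_right_ideal (r * p) \<inter> principal_right_ideal (r * g w) \<noteq> {}"
      using ne unfolding gw pair_class_mult_self_nonzero_iff .
    then obtain x y where "r * p * x = r * g w * y" by (force simp: principal_right_ideal_iff)
    then have "p * x = g w * y" by (metis left_cancel mult.assoc)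
    then have "principal_right_ideal (g w) \<inter> principal_right_ideal p \<noteq> {}"
      by (metis IntI emptyE principal_right_ideal_iff)
    then show "\<exists>f\<in>set (map g ?us). principal_right_ideal f \<inter> principal_right_ideal p \<noteq> {}"
      using w(1) rw by auto
  qed simp
  from boundary_foundation[OF this]
  have "?V\<^sup>\<star> * prod_list (map (\<lambda>w. 1 - boundary_representation w) ws) = 0"
    by (simp add: inter o_def)
  then show ?thesis by (simp add: boundary_representation_pair_class mult.assoc)
qed

text \<open>The element \<open>t\<close> is the meet of \<open>xs\<close>; for the empty list it is \<open>[1, 1]\<close>, which
  matches the empty product being \<open>1\<close>.\<close>

lemma idempotent_meet_exists:
  assumes "set xs \<subseteq> idempotents"
  obtains t where "t \<in> idempotents"
    "prod_list (map boundary_representation xs) = boundary_representation t"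
    "\<And>e. e \<in> idempotents \<Longrightarrow> e * t = e \<longleftrightarrow> (\<forall>x\<in>set xs. e * x = e)"
  using assms
proof (induction xs arbitrary: thesis)
  case Nil
  show ?case
    by (rule Nil(1)[of "pair_class 1 1"])
      (simp_all add: pair_class_self_idempotent boundary_representation_one)
next
  case (Cons x xs)
  from Cons.prems(2) obtain t where t: "t \<in> idempotents"
    "prod_list (map boundary_representation xs) = boundary_representation t"
    "\<And>e. e \<in> idempotents \<Longrightarrow> e * t = e \<longleftrightarrow> (\<forall>x\<in>set xs. e * x = e)"
    using Cons.IH by auto
  have x: "x \<in> idempotents" using Cons.prems by simp
  have "e * (x * t) = e \<longleftrightarrow> e * x = e \<and> e * t = e" for e
  proof
    assume "e * (x * t) = e"
    moreover have "x * t * t = x * t" "x * t * x = x * t"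
      using x t(1) idempotents_commute[OF x t(1)]
      by (simp_all add: idempotents_def mult.assoc) (metis mult.assoc)
    ultimately show "e * x = e \<and> e * t = e" by (metis mult.assoc)
  qed (simp flip: mult.assoc)
  then show ?case
    by (intro Cons.prems(1)[of "x * t"])
      (simp_all add: idempotents_mult x t boundary_representation_mult)
qed

lemma tight_boundary_representation:
  fixes xs ys zs :: "'p::right_lcm_monoid lcm_inverse_semigroup list"
  assumes xs: "set xs \<subseteq> idempotents" and ys: "set ys \<subseteq> idempotents"
    and cover: "is_cover (set zs) (idempotents_between (set xs) (set ys))"
  shows "join_list (map boundary_representation zs) = prod_list (map boundary_representation xs)
    * prod_list (map (\<lambda>y. 1 - boundary_representation y) ys)"
proof -
  let ?\<pi> = "boundary_representation :: _ \<Rightarrow> 'p boundary_quotient"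
  let ?Y = "prod_list (map (\<lambda>y. 1 - ?\<pi> y) ys)"
  let ?J = "join_list (map ?\<pi> zs)"
  obtain t where t: "t \<in> idempotents" "prod_list (map ?\<pi> xs) = ?\<pi> t"
    "\<And>e. e \<in> idempotents \<Longrightarrow> e * t = e \<longleftrightarrow> (\<forall>x\<in>set xs. e * x = e)"
    by (rule idempotent_meet_exists[OF xs]) blast
  have between: "e \<in> idempotents_between (set xs) (set ys) \<longleftrightarrow>
      e \<in> idempotents \<and> e * t = e \<and> (\<forall>y\<in>set ys. e * y = 0)" for e
    using t(3) by (auto simp: idempotents_between_def)
  have zs: "z \<in> idempotents" "z * t = z" "\<forall>y\<in>set ys. z * y = 0" if "z \<in> set zs" for z
    using that cover between by (auto simp: is_cover_def)
  \<comment> \<open>The join of \<open>zs\<close> lies below the right-hand side, as every member of \<open>zs\<close> does.\<close>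
  have "?\<pi> t * ?Y * ?J = ?J"
  proof (rule mult_join_list_absorb, clarsimp)
    fix z assume z: "z \<in> set zs"
    have "?\<pi> y * ?\<pi> z = 0" if "y \<in> set ys" for y
    proof -
      have "y * z = 0" using zs[OF z] that ys idempotents_commute by (metis subsetD)
      then show ?thesis by (simp add: boundary_representation_zero flip: boundary_representation_mult)
    qed
    then have "?Y * ?\<pi> z = ?\<pi> z" by (rule prod_complements_mult_orthogonal)
    moreover have "t * z = z" using zs[OF z] t(1) idempotents_commute by metis
    ultimately show "?\<pi> t * ?Y * ?\<pi> z = ?\<pi> z"
      by (simp add: mult.assoc flip: boundary_representation_mult)
  qed
  \<comment> \<open>The right-hand side lies below the join: here \<open>1 - ?J\<close> is the product of the complements
    of \<open>zs\<close>, so the claim is the localized foundation relation for \<open>ys @ zs\<close>.\<close>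
  moreover have "?\<pi> t * (?Y * (1 - ?J)) = 0"
    using t(1)
  proof (cases rule: idempotent_cases)
    case (2 r)
    have "?\<pi> (pair_class r r) * prod_list (map (\<lambda>w. 1 - ?\<pi> w) (ys @ zs)) = 0"
    proof (rule localized_foundation)
      show "set (ys @ zs) \<subseteq> idempotents" using ys zs by auto
    next
      fix p
      let ?q = "pair_class (r * p) (r * p)"
      show "\<exists>w\<in>set (ys @ zs). ?q * w \<noteq> 0"
      proof (cases "\<forall>y\<in>set ys. ?q * y = 0")
        case True
        have "?q * t = ?q" unfolding 2 by (rule pair_class_self_mult_absorb)
        then have "?q \<in> idempotents_between (set xs) (set ys)"
          using True by (simp add: between pair_class_self_idempotent)
        then obtain z where z: "z \<in> set zs" "z * ?q \<noteq> 0"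
          using cover pair_class_nonzero unfolding is_cover_def by blast
        then have "?q * z \<noteq> 0"
          using idempotents_commute[OF zs(1) pair_class_self_idempotent] by metis
        then show ?thesis using z by auto
      qed auto
    qed
    then show ?thesis by (simp add: 2 prod_complements_eq_join)
  qed (simp add: boundary_representation_zero)
  ultimately show ?thesis unfolding t(2) by (simp add: algebra_simps)
qed

lemma tight_representation_boundary_representation:
  "tight_representation boundary_representation"
  unfolding tight_representation_def
proof safe
  fix l r :: "'a boundary_quotient"
  assume "(l, r) \<in> tight_equations boundary_representation"
  then show "l = r"
    by cases (simp_all add: boundary_representation_mult boundary_representation_star
        boundary_representation_zero tight_boundary_representation)
qed


section \<open>The isomorphism\<close>

lemma star_homomorphism_id: "star_homomorphism id"
  by (simp add: star_homomorphism_def)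

theorem theorem3p7:
  shows "\<exists>\<Phi> :: 'p::right_lcm_monoid boundary_quotient \<Rightarrow> 'p lcm_inverse_semigroup tight_cstar_algebra.
    star_isomorphism \<Phi> \<and>
    (\<forall>p q. \<Phi> (boundary_v p * (boundary_v q)\<^sup>\<star>) = universal_tight (pair_class p q))"
proof -
  obtain \<Phi> :: "'p boundary_quotient \<Rightarrow> 'p lcm_inverse_semigroup tight_cstar_algebra"
    where \<Phi>: "star_homomorphism \<Phi>" "continuous_on UNIV \<Phi>"
      "\<And>p. \<Phi> (boundary_v p) = universal_tight (pair_class p 1)"
      "\<And>X. \<Phi> (boundary_e X) = universal_tight (ideal_idempotent X)"
    using boundary_quotient_universal[OF boundary_equations_universal_tight] by blast
  obtain \<Psi> :: "'p lcm_inverse_semigroup tight_cstar_algebra \<Rightarrow> 'p boundary_quotient"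
    where \<Psi>: "star_homomorphism \<Psi>" "continuous_on UNIV \<Psi>"
      "\<And>s. \<Psi> (universal_tight s) = boundary_representation s"
    using universal_tight_universal[OF tight_representation_boundary_representation] by blast
  have pq: "\<Phi> (boundary_v p * (boundary_v q)\<^sup>\<star>) = universal_tight (pair_class p q)" for p q
    by (simp add: star_homomorphism_simps[OF \<Phi>(1)] \<Phi>(3) star_pair_class pair_class_factor
        flip: universal_tight_star universal_tight_mult)
  have "\<Psi> \<circ> \<Phi> = id"
  proof (rule star_homomorphism_universal_unique)
    fix g :: "'p boundary_generator"
    show "(\<Psi> \<circ> \<Phi>) (universal_gen g) = id (universal_gen g)"
    proof (cases g)
      case (Isometry p)
      have "\<Psi> (\<Phi> (boundary_v p)) = boundary_v p"
        by (simp add: \<Phi>(3) \<Psi>(3) boundary_representation_pair_class boundary_v_one)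
      then show ?thesis by (simp add: Isometry boundary_v_def)
    next
      case (Projection X)
      have "\<Psi> (\<Phi> (boundary_e X)) = boundary_e X"
        by (simp add: \<Phi>(4) \<Psi>(3) boundary_representation_ideal_idempotent)
      then show ?thesis by (simp add: Projection boundary_e_def)
    qed
  qed (use \<Phi> \<Psi> in \<open>auto intro: star_homomorphism_comp star_homomorphism_id
      continuous_on_compose2[of UNIV]\<close>)
  moreover have "\<Phi> \<circ> \<Psi> = id"
  proof (rule star_homomorphism_universal_unique)
    fix g :: "'p lcm_inverse_semigroup tight_generator"
    obtain s where g: "g = Tight s" by (cases g)
    have "\<Phi> (\<Psi> (universal_tight s)) = universal_tight s"
      by (cases s rule: pair_class_cases)
        (simp_all add: \<Psi>(3) boundary_representation_zero universal_tight_zero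
          star_homomorphism_0[OF \<Phi>(1)] star_homomorphism_0[OF \<Psi>(1)] boundary_representation_pair_class pq)
    then show "(\<Phi> \<circ> \<Psi>) (universal_gen g) = id (universal_gen g)"
      by (simp add: g universal_tight_def)
  qed (use \<Phi> \<Psi> in \<open>auto intro: star_homomorphism_comp star_homomorphism_id
      continuous_on_compose2[of UNIV]\<close>)
  ultimately have "bij \<Phi>" by (rule o_bij)
  with \<Phi>(1) pq show ?thesis by (auto simp: star_isomorphism_def)
qed

end
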